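(* Let $\tau\in\mathbb{H}$ and $\lambda\in\mathbb{C}-\{0,1\}$ be such that $j(\tau)=256\frac{(\lambda^2-\lambda+1)^3}{(\lambda^2-\lambda)^2}$. Then the following equality of sets holds: $$\left\{j\left(2\tau\right),\,j\left(\frac{\tau}{2}\right),\,j\left(\frac{\tau+1}{-\tau+1}\right)\right\}=\left\{16\,\frac{\left(u+\frac{1}{u}+14\right)^3}{\left(u+\frac{1}{u}-2\right)^2}\ \Bigg|\ u\in\left\{\lambda,\,1-\lambda,\,\frac{\lambda-1}{\lambda}\right\}\right\}.$$
   Context: $\mathbb{H}$ is the upper half plane. $j:\mathbb{H}\to\mathbb{C}$ is the usual modular $j$-function for $\mathrm{SL}_2(\mathbb{Z})$, normalized so that $j(\tau)=\frac1q+744+196884q+\cdots$ with $q=e^{2\pi\mathrm{i}\tau}$ (so $j(\mathrm{i})=1728$). *)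

theory Defs
  imports "HOL-Complex_Analysis.Complex_Analysis"
begin

text \<open>
  The modular \<open>j\<close>-function of a point \<open>\<tau>\<close> of the upper half plane, defined through the lattice
  \<open>\<int>\<tau> + \<int>\<close>. For \<open>k \<ge> 3\<close> and \<open>Im \<tau> > 0\<close> the Eisenstein series converges absolutely, so the
  unordered sum below is the usual one. Outside the upper half plane the values carry no meaning.
\<close>

definition eisenstein_G :: "nat \<Rightarrow> complex \<Rightarrow> complex" where
  "eisenstein_G k \<tau> =
     (\<Sum>\<^sub>\<infinity>(m, n)\<in>(UNIV :: (int \<times> int) set) - {(0, 0)}. 1 / (of_int m * \<tau> + of_int n) ^ k)"

definition invariant_g2 :: "complex \<Rightarrow> complex" where
  "invariant_g2 \<tau> = 60 * eisenstein_G 4 \<tau>"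

definition invariant_g3 :: "complex \<Rightarrow> complex" where
  "invariant_g3 \<tau> = 140 * eisenstein_G 6 \<tau>"

text \<open>
  The factor 1728 gives the normalization \<open>j(\<tau>) = 1/q + 744 + 196884 q + \<dots>\<close> with
  \<open>q = exp (2 \<pi> \<i> \<tau>)\<close>, and \<open>j(\<i>) = 1728\<close>. The discriminant in the denominator does not vanish
  on the upper half plane.
\<close>

definition modular_j :: "complex \<Rightarrow> complex" where
  "modular_j \<tau> =
     1728 * invariant_g2 \<tau> ^ 3 / (invariant_g2 \<tau> ^ 3 - 27 * invariant_g3 \<tau> ^ 2)"

end

theory Submission
  imports Defs
begin

text \<open>
  Up to scaling, the lattices of \<open>2\<tau>\<close>, \<open>\<tau>/2\<close> and \<open>(\<tau>+1)/(-\<tau>+1)\<close> are the three lattices that contain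
  \<open>L = \<int>\<tau> + \<int>\<close> with index 2, each generated by \<open>L\<close> and a half period \<open>h\<close>. Their Eisenstein series are
  those of \<open>L\<close> plus the sums of \<open>(h + l)\<^sup>-\<^sup>4\<close> and \<open>(h + l)\<^sup>-\<^sup>6\<close> over \<open>l \<in> L\<close>, that is, derivatives of the
  Weierstrass function at \<open>h\<close>, which its differential equation expresses through its value \<open>e\<^sub>1\<close> at \<open>h\<close>.
  If \<open>e\<^sub>1, e\<^sub>2, e\<^sub>3\<close> are the values at the three half periods and \<open>\<mu> = (e\<^sub>1 - e\<^sub>2) / (e\<^sub>1 - e\<^sub>3)\<close>, then
  \<open>j(\<tau>)\<close> is the degree 6 rational function of the statement at \<open>\<mu>\<close>, and the \<open>j\<close>-invariant of the
  superlattice of \<open>e\<^sub>1\<close> is the right-hand expression at \<open>u = \<mu>\<close>; permuting the \<open>e\<^sub>i\<close> gives the other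
  two. Finally \<open>\<lambda>\<close> and \<open>\<mu>\<close> lie in one orbit of the anharmonic group, which preserves the right-hand set.
\<close>

section \<open>Termwise differentiation and absolute convergence over pairs of integers\<close>

text \<open>The majorant makes the finite partial sums converge uniformly on a smaller disk, and
  locally uniform limits of holomorphic functions may be differentiated termwise.\<close>

lemma has_field_derivative_infsum:
  fixes f f' :: "'a \<Rightarrow> complex \<Rightarrow> complex"
  assumes "r > 0"
    and deriv: "\<And>p w. p \<in> A \<Longrightarrow> w \<in> ball z r \<Longrightarrow> (f p has_field_derivative f' p w) (at w)"
    and bound: "\<And>p w. p \<in> A \<Longrightarrow> w \<in> ball z r \<Longrightarrow> norm (f p w) \<le> M p"
    and summable: "M summable_on A"
  shows "((\<lambda>w. \<Sum>\<^sub>\<infinity>p\<in>A. f p w) has_field_derivative (\<Sum>\<^sub>\<infinity>p\<in>A. f' p z)) (at z)"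
proof -
  have sub: "cball z (r/2) \<subseteq> ball z r" using \<open>r > 0\<close> by (auto simp: dist_norm)
  have ul: "uniform_limit (cball z (r/2)) (\<lambda>X w. \<Sum>p\<in>X. f p w) (\<lambda>w. \<Sum>\<^sub>\<infinity>p\<in>A. f p w)
             (finite_subsets_at_top A)"
    by (rule Weierstrass_m_test_general[OF _ summable]) (use bound sub in blast)
  have "\<forall>\<^sub>F X in finite_subsets_at_top A. continuous_on (cball z (r/2)) (\<lambda>w. \<Sum>p\<in>X. f p w) \<and>
     (\<forall>w \<in> ball z (r/2). ((\<lambda>w. \<Sum>p\<in>X. f p w) has_field_derivative (\<Sum>p\<in>X. f' p w)) (at w))"
    unfolding eventually_finite_subsets_at_top
  proof (rule exI[of _ "{}"], safe)
    fix X assume X: "finite X" "X \<subseteq> A"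
    have d: "((\<lambda>w. \<Sum>p\<in>X. f p w) has_field_derivative (\<Sum>p\<in>X. f' p w)) (at w)"
      if "w \<in> cball z (r/2)" for w
      using X that sub by (intro DERIV_sum deriv) auto
    show "continuous_on (cball z (r/2)) (\<lambda>w. \<Sum>p\<in>X. f p w)"
      by (rule DERIV_continuous_on) (use d in \<open>auto intro: has_field_derivative_at_within\<close>)
    show "((\<lambda>w. \<Sum>p\<in>X. f p w) has_field_derivative (\<Sum>p\<in>X. f' p w)) (at w)"
      if "w \<in> ball z (r/2)" for w
      using d that by auto
  qed
  from has_complex_derivative_uniform_limit[OF this ul]
  obtain g' where g': "\<And>w. w \<in> ball z (r/2) \<Longrightarrow>
      ((\<lambda>w. \<Sum>\<^sub>\<infinity>p\<in>A. f p w) has_field_derivative g' w) (at w) \<and>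
      ((\<lambda>X. \<Sum>p\<in>X. f' p w) \<longlongrightarrow> g' w) (finite_subsets_at_top A)"
    using \<open>r > 0\<close> by auto
  have z: "z \<in> ball z (r/2)" using \<open>r > 0\<close> by simp
  have "((\<lambda>p. f' p z) has_sum g' z) A"
    using g'[OF z] by (simp add: has_sum_def)
  then show ?thesis using g'[OF z] by (simp add: infsumI)
qed

text \<open>The added 1 keeps the value positive at the index 0, so that
  \<open>1 / height p ^ 3\<close> can serve as a majorant over any index set.\<close>

definition height :: "int \<times> int \<Rightarrow> real" where
  "height = (\<lambda>(m, n). 1 + \<bar>of_int m\<bar> + \<bar>of_int n\<bar>)"

lemma height_ge_1: "1 \<le> height p"
  by (cases p) (simp add: height_def)

lemma finite_height_le: "finite {p. height p \<le> B}"
proof (rule finite_subset)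
  show "{p. height p \<le> B} \<subseteq> {-\<lceil>B\<rceil>..\<lceil>B\<rceil>} \<times> {-\<lceil>B\<rceil>..\<lceil>B\<rceil>}"
  proof
    fix p assume p: "p \<in> {p. height p \<le> B}"
    obtain m n where mn: "p = (m, n)" by force
    have "of_int \<bar>m\<bar> \<le> B" "of_int \<bar>n\<bar> \<le> B" using p mn by (auto simp: height_def)
    then have "\<bar>m\<bar> \<le> \<lceil>B\<rceil>" "\<bar>n\<bar> \<le> \<lceil>B\<rceil>" by linarith+
    then show "p \<in> {-\<lceil>B\<rceil>..\<lceil>B\<rceil>} \<times> {-\<lceil>B\<rceil>..\<lceil>B\<rceil>}" using mn by auto
  qed
qed auto

text \<open>The exponent 3/2 is half of 3: a product of two such terms is to dominate
  \<open>1 / height p ^ 3\<close>.\<close>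

lemma summable_inverse_int_powr:
  "(\<lambda>m::int. (1 + \<bar>of_int m\<bar>) powr - (3/2) :: real) summable_on UNIV"
proof -
  let ?f = "\<lambda>m::int. (1 + \<bar>of_int m\<bar>) powr - (3/2) :: real"
  have "summable (\<lambda>n. real (Suc n) powr - (3/2))"
    by (subst summable_Suc_iff) (simp add: summable_real_powr_iff)
  then have nat: "(\<lambda>n. (1 + real n) powr - (3/2)) summable_on UNIV"
    by (subst summable_on_UNIV_nonneg_real_iff) (auto simp: add.commute)
  have "?f summable_on range int"
    by (subst summable_on_reindex) (use nat in \<open>auto simp: o_def\<close>)
  moreover have "?f summable_on range (\<lambda>n. - int n)"
    by (subst summable_on_reindex) (use nat in \<open>auto simp: o_def inj_on_def\<close>)
  ultimately have "?f summable_on range int \<union> range (\<lambda>n. - int n)"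
    by (rule summable_on_union)
  moreover have "range int \<union> range (\<lambda>n. - int n) = UNIV"
  proof -
    have "m \<in> range int \<union> range (\<lambda>n. - int n)" for m by (cases m rule: int_cases2) auto
    then show ?thesis by blast
  qed
  ultimately show ?thesis by simp
qed

text \<open>With \<open>x\<close> and \<open>y\<close> one more than the absolute coordinates,
  \<open>x * y\<close> is at most \<open>height p ^ 2\<close>, which bounds the terms by a product
  of two convergent one-variable series.\<close>

lemma summable_inverse_height_cube: "(\<lambda>p. 1 / height p ^ 3) summable_on UNIV"
proof -
  let ?a = "\<lambda>m::int. (1 + \<bar>of_int m\<bar>) powr - (3/2) :: real"
  have "(\<lambda>(m, n). ?a m * ?a n) summable_on UNIV \<times> UNIV"
    using summable_inverse_int_powr
    by (intro summable_on_SigmaI[where g = "\<lambda>m. ?a m * infsum ?a UNIV"])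
       (auto intro!: has_sum_cmult_right has_sum_infsum summable_on_cmult_left)
  then have s: "(\<lambda>(m, n). ?a m * ?a n) summable_on UNIV" by simp
  show ?thesis
  proof (rule summable_on_comparison_test[OF s])
    fix p :: "int \<times> int"
    obtain m n where p: "p = (m, n)" by force
    define x y where "x = 1 + \<bar>real_of_int m\<bar>" and "y = 1 + \<bar>real_of_int n\<bar>"
    have xy: "x \<ge> 1" "y \<ge> 1" by (auto simp: x_def y_def)
    have h: "height p = x + y - 1" by (simp add: p height_def x_def y_def)
    have hp: "height p > 0" using height_ge_1[of p] by linarith
    have "x * y \<le> (x + y - 1)^2"
    proof -
      have "(x + y - 1)^2 - x * y = (x - 1) * (x - 1) + (y - 1) * (y - 1) + (x*y - 1)"
        by (simp add: power2_eq_square algebra_simps)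
      moreover have "1 * 1 \<le> x * y" by (rule mult_mono) (use xy in auto)
      ultimately show ?thesis by (smt (verit) zero_le_square)
    qed
    then have "(x * y) powr (3/2) \<le> (height p ^ 2) powr (3/2)"
      unfolding h using xy by (intro powr_mono2) auto
    also have "\<dots> = height p ^ 3"
      using hp by (simp flip: powr_numeral add: powr_powr)
    finally have le: "(x * y) powr (3/2) \<le> height p ^ 3" .
    have "1 / height p ^ 3 \<le> 1 / (x * y) powr (3/2)"
      by (rule divide_left_mono[OF le]) (use xy hp in auto)
    also have "\<dots> = x powr - (3/2) * y powr - (3/2)"
      using xy by (simp add: powr_minus powr_mult field_simps)
    finally show "1 / height p ^ 3 \<le> (case p of (m, n) \<Rightarrow> ?a m * ?a n)"
      by (simp add: p x_def y_def)
    show "0 \<le> 1 / height p ^ 3" using hp by simp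
  qed
qed

lemma DERIV_inverse_shift_power:
  fixes a w :: complex
  assumes "w + a \<noteq> 0"
  shows "((\<lambda>w. 1 / (w + a) ^ k) has_field_derivative - of_nat k * (1 / (w + a) ^ Suc k)) (at w)"
proof -
  have "((\<lambda>w. inverse (w + a) ^ k) has_field_derivative
      of_nat k * inverse (w + a) ^ (k - 1) * - (inverse (w + a) * inverse (w + a))) (at w)"
    by (rule derivative_eq_intros refl assms | simp)+
  moreover have "of_nat k * inverse (w + a) ^ (k - 1) * - (inverse (w + a) * inverse (w + a)) =
      - of_nat k * inverse (w + a) ^ Suc k"
    by (cases k) (simp_all add: algebra_simps)
  ultimately show ?thesis by (simp only: divide_inverse power_inverse mult_1_left)
qed

subsection \<open>Lattice sums and the Weierstrass function\<close>

locale half_plane_point =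
  fixes \<tau> :: complex
  assumes Im_pos: "Im \<tau> > 0"
begin

definition pt :: "int \<times> int \<Rightarrow> complex" where
  "pt = (\<lambda>(m, n). of_int m * \<tau> + of_int n)"

text \<open>
  \<open>E UNIV k\<close> is Eisenstein's series \<open>E\<^sub>k(z)\<close>; omitting the index \<open>0\<close> removes its pole at the origin.
  Likewise \<open>R\<close> is the regular part at \<open>0\<close> of the Weierstrass function \<open>wp\<close>.
\<close>

definition E :: "(int \<times> int) set \<Rightarrow> nat \<Rightarrow> complex \<Rightarrow> complex" where
  "E A k z = (\<Sum>\<^sub>\<infinity>p\<in>A. 1 / (z + pt p) ^ k)"

definition R :: "complex \<Rightarrow> complex" where
  "R z = (\<Sum>\<^sub>\<infinity>p\<in>-{0}. 1 / (z + pt p)\<^sup>2 - 1 / (pt p)\<^sup>2)"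

definition wp :: "complex \<Rightarrow> complex" where
  "wp z = 1 / z\<^sup>2 + R z"

lemma pt_add: "pt (p + q) = pt p + pt q"
  by (cases p; cases q) (simp add: pt_def algebra_simps)

lemma pt_minus: "pt (- p) = - pt p"
  by (cases p) (simp add: pt_def)

lemma pt_diff: "pt (p - q) = pt p - pt q"
  using pt_add[of p "- q"] by (simp add: pt_minus)

lemma pt_0 [simp]: "pt 0 = 0"
  by (simp add: pt_def zero_prod_def)

text \<open>The imaginary part of a lattice point controls the first coordinate; the triangle
  inequality then controls the second.\<close>

lemma pt_lower_bound:
  obtains c where "c > 0" "\<And>p. c * (height p - 1) \<le> norm (pt p)"
proof -
  define t where "t = Im \<tau>"
  define C where "C = (1 + norm \<tau>) / t + 1"
  have t: "t > 0" using Im_pos by (simp add: t_def)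
  have C: "C > 0" using t by (simp add: C_def add_nonneg_pos)
  have "height p - 1 \<le> C * norm (pt p)" for p
  proof -
    obtain m n where p: "p = (m, n)" by force
    have "\<bar>of_int m\<bar> * t = \<bar>Im (pt p)\<bar>"
      using t by (simp add: p pt_def t_def abs_mult)
    then have "\<bar>of_int m\<bar> * t \<le> norm (pt p)"
      using abs_Im_le_cmod[of "pt p"] by simp
    then have m: "\<bar>of_int m\<bar> \<le> norm (pt p) / t" using t by (simp add: field_simps)
    have "\<bar>of_int n\<bar> = norm (pt p - of_int m * \<tau>)" by (simp add: p pt_def)
    also have "\<dots> \<le> norm (pt p) + \<bar>of_int m\<bar> * norm \<tau>"
      using norm_triangle_ineq4[of "pt p" "of_int m * \<tau>"] by (simp add: norm_mult)
    also have "\<dots> \<le> norm (pt p) + norm (pt p) / t * norm \<tau>"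
      using m by (intro add_left_mono mult_right_mono) auto
    finally show ?thesis using m by (simp add: height_def p C_def algebra_simps add_divide_distrib)
  qed
  then have "1 / C * (height p - 1) \<le> norm (pt p)" for p
    using C by (simp add: field_simps)
  then show ?thesis using C that[of "1 / C"] by auto
qed

lemma pt_eq_0_iff: "pt p = 0 \<longleftrightarrow> p = 0"
proof
  assume *: "pt p = 0"
  from pt_lower_bound obtain c where "c > 0" "c * (height p - 1) \<le> norm (pt p)" by metis
  then have "height p \<le> 1" using * by (simp add: mult_le_0_iff)
  then show "p = 0" by (cases p) (auto simp: height_def zero_prod_def)
qed simp

lemma pt_inj: "pt p = pt q \<longleftrightarrow> p = q"
  using pt_eq_0_iff[of "p - q"] by (simp add: pt_diff)

text \<open>For all but finitely many indices the lattice point dominates \<open>z\<close>; the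
  others contribute a minimum of finitely many positive numbers.\<close>

lemma local_lower_bound:
  assumes "\<And>p. p \<in> A \<Longrightarrow> z + pt p \<noteq> 0"
  obtains c r where "c > 0" "r > 0"
    "\<And>w p. w \<in> ball z r \<Longrightarrow> p \<in> A \<Longrightarrow> c * height p \<le> norm (w + pt p)"
proof -
  obtain c0 where c0: "c0 > 0" "\<And>p. c0 * (height p - 1) \<le> norm (pt p)"
    by (rule pt_lower_bound) blast
  \<comment> \<open>Outside \<open>K\<close>, half of \<open>c0 * height p\<close> is large enough
    to absorb both \<open>c0\<close> and \<open>norm z\<close>.\<close>
  define K where "K = {p \<in> A. height p \<le> 2 * (c0 + norm z) / c0}"
  define c where "c = Min (insert (c0 / 2) ((\<lambda>p. norm (z + pt p) / height p) ` K))"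
  have hp: "height p > 0" for p using height_ge_1[of p] by linarith
  have fin: "finite K" unfolding K_def
    by (rule finite_subset[OF _ finite_height_le]) auto
  have c: "c > 0" unfolding c_def
    using fin c0 hp assms by (subst Min_gr_iff) (auto simp: K_def)
  have low: "c * height p \<le> norm (z + pt p)" if p: "p \<in> A" for p
  proof (cases "p \<in> K")
    case True
    then have "c \<le> norm (z + pt p) / height p" unfolding c_def using fin by auto
    then show ?thesis using hp[of p] by (simp add: field_simps)
  next
    case False
    then have *: "2 * (c0 + norm z) \<le> c0 * height p"
      using p c0 by (simp add: K_def field_simps)
    have "c \<le> c0 / 2" unfolding c_def by (rule Min_le) (use fin in auto)
    then have "c * height p \<le> c0 / 2 * height p" using hp[of p] by (intro mult_right_mono) auto
    also have "\<dots> \<le> c0 * (height p - 1) - norm z" using * by (simp add: algebra_simps)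
    also have "\<dots> \<le> norm (pt p) - norm z" using c0(2)[of p] by simp
    also have "\<dots> \<le> norm (z + pt p)" using norm_triangle_ineq4[of "z + pt p" z] by simp
    finally show ?thesis .
  qed
  show ?thesis
  \<comment> \<open>Moving the centre by less than \<open>c/2\<close>, which is at most
    \<open>c/2 * height p\<close>, costs at most half of the bound.\<close>
  proof (rule that[of "c/2" "c/2"])
    fix w p assume w: "w \<in> ball z (c/2)" and p: "p \<in> A"
    have "norm (z + pt p) \<le> norm (w + pt p) + norm (z - w)"
      using norm_triangle_ineq[of "w + pt p" "z - w"] by (simp add: add.commute)
    moreover have "norm (z - w) \<le> c / 2 * height p"
    proof -
      have "norm (z - w) \<le> c / 2" using w by (simp add: dist_norm)
      also have "\<dots> \<le> c / 2 * height p"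
        using mult_left_mono[OF height_ge_1[of p], of "c / 2"] c by simp
      finally show ?thesis .
    qed
    ultimately show "c/2 * height p \<le> norm (w + pt p)" using low[OF p] by simp
  qed (use c in auto)
qed

text \<open>Heights are at least 1, so the exponent \<open>k\<close> may be lowered to 3 and one
  summable majorant serves all \<open>k\<close>.\<close>

lemma term_bound:
  fixes w :: complex
  assumes "c > 0" "k \<ge> 3" "c * height p \<le> norm w"
  shows "norm (1 / w ^ k) \<le> 1 / c ^ k * (1 / height p ^ 3)"
proof -
  have h: "height p \<ge> 1" by (rule height_ge_1)
  have "0 < c * height p" using assms(1) h by simp
  then have w: "w \<noteq> 0" using assms(3) by auto
  have "c ^ k * height p ^ 3 \<le> c ^ k * height p ^ k"
    using assms h by (intro mult_left_mono power_increasing) auto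
  also have "\<dots> \<le> norm w ^ k"
    using assms h by (simp flip: power_mult_distrib add: power_mono)
  finally have "1 / norm w ^ k \<le> 1 / (c ^ k * height p ^ 3)"
    using assms h w by (intro divide_left_mono) auto
  then show ?thesis by (simp add: norm_divide norm_power)
qed

lemma summable_bound: "(\<lambda>p. C * (1 / height p ^ 3)) summable_on A"
  by (intro summable_on_cmult_right summable_on_subset[OF summable_inverse_height_cube]) auto

lemma E_summable:
  assumes "\<And>p. p \<in> A \<Longrightarrow> z + pt p \<noteq> 0" "k \<ge> 3"
  shows "(\<lambda>p. 1 / (z + pt p) ^ k) summable_on A"
proof -
  obtain c r where c: "c > 0" "r > 0"
    "\<And>w p. w \<in> ball z r \<Longrightarrow> p \<in> A \<Longrightarrow> c * height p \<le> norm (w + pt p)"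
    using local_lower_bound[of A z] assms(1) by blast
  show ?thesis
    by (rule abs_summable_summable, rule Infinite_Sum.abs_summable_on_comparison_test'[OF summable_bound])
       (rule term_bound[OF c(1) assms(2)], use c in auto)
qed

lemma E_deriv:
  assumes nz: "\<And>p. p \<in> A \<Longrightarrow> z + pt p \<noteq> 0" and k: "k \<ge> 3"
  shows "(E A k has_field_derivative - of_nat k * E A (Suc k) z) (at z)"
proof -
  obtain c r where c: "c > 0" "r > 0"
    "\<And>w p. w \<in> ball z r \<Longrightarrow> p \<in> A \<Longrightarrow> c * height p \<le> norm (w + pt p)"
    using local_lower_bound[of A z] nz by blast
  have nz': "w + pt p \<noteq> 0" if "w \<in> ball z r" "p \<in> A" for w p
  proof -
    have "0 < c * height p" using c(1) height_ge_1[of p] by simp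
    also note c(3)[OF that]
    finally show ?thesis by simp
  qed
  have "((\<lambda>w. \<Sum>\<^sub>\<infinity>p\<in>A. 1 / (w + pt p) ^ k) has_field_derivative
         (\<Sum>\<^sub>\<infinity>p\<in>A. - of_nat k * (1 / (z + pt p) ^ Suc k))) (at z)"
  proof (rule has_field_derivative_infsum[OF c(2) _ _ summable_bound])
    fix p w assume pw: "p \<in> A" "w \<in> ball z r"
    show "norm (1 / (w + pt p) ^ k) \<le> 1 / c ^ k * (1 / height p ^ 3)"
      by (rule term_bound[OF c(1) k]) (use c pw in auto)
    show "((\<lambda>w. 1 / (w + pt p) ^ k) has_field_derivative
        - of_nat k * (1 / (w + pt p) ^ Suc k)) (at w)"
      by (rule DERIV_inverse_shift_power) (use nz' pw in auto)
  qed
  then show ?thesis by (simp only: E_def[abs_def] infsum_cmult_right')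
qed

text \<open>Quadratic decay is too slow for absolute convergence, so the majorant has to come from
  the difference of the two terms, which decays cubically.\<close>

lemma R_deriv:
  assumes nz: "\<And>p. p \<noteq> 0 \<Longrightarrow> z + pt p \<noteq> 0"
  shows "(R has_field_derivative - 2 * E (-{0}) 3 z) (at z)"
proof -
  obtain c r where c: "c > 0" "r > 0"
    "\<And>w p. w \<in> ball z r \<Longrightarrow> p \<in> -{0} \<Longrightarrow> c * height p \<le> norm (w + pt p)"
    using local_lower_bound[of "-{0}" z] nz by (metis ComplD singletonI)
  \<comment> \<open>A second bound, centred at 0, for the subtracted terms; the smaller constant
    serves both.\<close>
  obtain c0 where c0: "c0 > 0" "\<And>p. p \<in> -{0} \<Longrightarrow> c0 * height p \<le> norm (pt p)"
    using local_lower_bound[of "-{0}" 0] pt_eq_0_iff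
    by (metis ComplD add_0 centre_in_ball singletonI)
  define d where "d = min c c0"
  have d: "d > 0" "d \<le> c" "d \<le> c0" using c c0 by (auto simp: d_def)
  have dw: "d * height p \<le> norm (w + pt p)" and d0: "d * height p \<le> norm (pt p)"
    if "w \<in> ball z r" "p \<in> -{0}" for w p
  proof -
    have "d * height p \<le> c * height p" "d * height p \<le> c0 * height p"
      using d height_ge_1[of p] by (auto intro!: mult_right_mono)
    then show "d * height p \<le> norm (w + pt p)" "d * height p \<le> norm (pt p)"
      using c(3)[OF that] c0(2)[OF that(2)] by linarith+
  qed
  have pos: "0 < d * height p" for p using d(1) height_ge_1[of p] by simp
  have "((\<lambda>w. \<Sum>\<^sub>\<infinity>p\<in>-{0}. 1 / (w + pt p)\<^sup>2 - 1 / (pt p)\<^sup>2) has_field_derivative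
         (\<Sum>\<^sub>\<infinity>p\<in>-{0}. - 2 * (1 / (z + pt p) ^ 3))) (at z)"
  proof (rule has_field_derivative_infsum[OF c(2) _ _ summable_bound])
    fix p w assume pw: "p \<in> -{0::int \<times> int}" "w \<in> ball z r"
    define x y where "x = w + pt p" and "y = pt p"
    have x: "d * height p \<le> norm x" and y: "d * height p \<le> norm y"
      using dw[OF pw(2,1)] d0[OF pw(2,1)] by (auto simp: x_def y_def)
    have x0: "x \<noteq> 0" "y \<noteq> 0" using x y pos[of p] by auto
    show "((\<lambda>w. 1 / (w + pt p)\<^sup>2 - 1 / (pt p)\<^sup>2) has_field_derivative
        - 2 * (1 / (w + pt p) ^ 3)) (at w)"
      using DERIV_diff[OF DERIV_inverse_shift_power[of w "pt p" 2] DERIV_const] x0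
      by (simp add: x_def numeral_3_eq_3 numeral_2_eq_2)
    \<comment> \<open>Pulling out \<open>w = x - y\<close> gains one power of decay.\<close>
    have "1 / x\<^sup>2 - 1 / y\<^sup>2 = - w * (1 / (x\<^sup>2 * y) + 1 / (x * y\<^sup>2))"
    proof -
      have "w = x - y" by (simp add: x_def y_def)
      moreover have "1 / x\<^sup>2 - 1 / y\<^sup>2 = - (x - y) * (1 / (x\<^sup>2 * y) + 1 / (x * y\<^sup>2))"
        using x0 by (simp add: divide_simps) (simp add: algebra_simps power2_eq_square)
      ultimately show ?thesis by simp
    qed
    then have "norm (1 / x\<^sup>2 - 1 / y\<^sup>2) = norm w * norm (1 / (x\<^sup>2 * y) + 1 / (x * y\<^sup>2))"
      by (simp add: norm_mult)
    also have "\<dots> \<le> norm w * (1 / (norm x ^ 2 * norm y) + 1 / (norm x * norm y ^ 2))"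
      by (intro mult_left_mono order.trans[OF norm_triangle_ineq])
         (auto simp: norm_divide norm_mult norm_power)
    also have "\<dots> \<le> norm w * (1 / (d * height p) ^ 3 + 1 / (d * height p) ^ 3)"
    proof (intro mult_left_mono add_mono divide_left_mono)
      have cube: "t ^ 3 \<le> a ^ 2 * b" if "t \<le> a" "t \<le> b" "0 < t" for a b t :: real
        unfolding power3_eq_cube power2_eq_square using that by (intro mult_mono) auto
      show "(d * height p) ^ 3 \<le> norm x ^ 2 * norm y"
        by (rule cube[OF x y pos])
      show "(d * height p) ^ 3 \<le> norm x * norm y ^ 2"
        using cube[OF y x pos] by (simp add: mult.commute)
    qed (use x0 pos[of p] in auto)
    also have "\<dots> \<le> (norm z + r) * (1 / (d * height p) ^ 3 + 1 / (d * height p) ^ 3)"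
      using pw(2) norm_triangle_ineq2[of w z] pos[of p] less_imp_le[OF pos[of p]]
      by (intro mult_right_mono) (auto simp: dist_norm norm_minus_commute)
    also have "\<dots> = (norm z + r) * (2 / d ^ 3) * (1 / height p ^ 3)"
      by (simp add: power_mult_distrib)
    finally show "norm (1 / (w + pt p)\<^sup>2 - 1 / (pt p)\<^sup>2) \<le>
        (norm z + r) * (2 / d ^ 3) * (1 / height p ^ 3)"
      by (simp add: x_def y_def)
  qed
  then show ?thesis by (simp only: E_def R_def[abs_def] infsum_cmult_right')
qed

lemma E_shift: "E UNIV k (z + pt q) = E UNIV k z"
proof -
  have "E UNIV k z = (\<Sum>\<^sub>\<infinity>p\<in>UNIV. 1 / (z + pt (p + q)) ^ k)"
    unfolding E_def by (rule infsum_reindex_bij_betw[symmetric])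
      (auto simp: bij_betw_def inj_on_def intro!: surjI[of _ "\<lambda>p. p - q"])
  then show ?thesis by (simp add: E_def pt_add algebra_simps)
qed

lemma E_uminus:
  assumes "uminus ` A = A"
  shows "E A k (- z) = (-1) ^ k * E A k z"
proof -
  have "E A k (- z) = (\<Sum>\<^sub>\<infinity>p\<in>A. 1 / (- z + pt (- p)) ^ k)"
    unfolding E_def by (rule infsum_reindex_bij_betw[symmetric])
      (auto simp: bij_betw_def inj_on_def assms)
  also have "\<dots> = (\<Sum>\<^sub>\<infinity>p\<in>A. (-1) ^ k * (1 / (z + pt p) ^ k))"
  proof (rule infsum_cong)
    fix p
    have "- z + pt (- p) = (-1) * (z + pt p)" by (simp add: pt_minus)
    then show "1 / (- z + pt (- p)) ^ k = (-1) ^ k * (1 / (z + pt p) ^ k)"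
      by (cases "even k") (simp_all only: power_mult_distrib, simp_all)
  qed
  finally show ?thesis by (simp only: E_def infsum_cmult_right')
qed

lemma uminus_image_nonzero: "uminus ` (-{0}) = -{0 :: int \<times> int}"
  by (metis bij_image_Compl_eq bij_uminus image_empty image_insert minus_zero)

lemma R_uminus: "R (- z) = R z"
proof -
  have "R (- z) = (\<Sum>\<^sub>\<infinity>p\<in>-{0}. 1 / (- z + pt (- p))\<^sup>2 - 1 / (pt (- p))\<^sup>2)"
    unfolding R_def by (rule infsum_reindex_bij_betw[symmetric])
      (auto simp: bij_betw_def inj_on_def uminus_image_nonzero)
  also have "\<dots> = R z" unfolding R_def
    by (rule infsum_cong) (simp add: pt_minus power2_eq_square algebra_simps)
  finally show ?thesis .
qed

lemma wp_uminus: "wp (- z) = wp z"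
  by (simp add: wp_def R_uminus)

lemma R_0 [simp]: "R 0 = 0"
  by (simp add: R_def)

lemma E_UNIV_eq:
  assumes "\<And>p. p \<noteq> 0 \<Longrightarrow> z + pt p \<noteq> 0" "k \<ge> 3"
  shows "E UNIV k z = 1 / z ^ k + E (-{0}) k z"
proof -
  have "(\<Sum>\<^sub>\<infinity>p\<in>insert 0 (-{0}). 1 / (z + pt p) ^ k) = 1 / (z + pt 0) ^ k + E (-{0}) k z"
    unfolding E_def by (rule infsum_insert) (use assms E_summable[of "-{0}" z k] in auto)
  moreover have "insert 0 (-{0}) = (UNIV :: (int \<times> int) set)" by auto
  ultimately show ?thesis by (simp add: E_def)
qed

lemma eisenstein_G_eq: "eisenstein_G k \<tau> = E (-{0}) k 0"
  unfolding eisenstein_G_def E_def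
  by (rule infsum_cong_neutral) (auto simp: pt_def zero_prod_def)

end

section \<open>Taylor remainders, periodicity and Liouville's theorem\<close>

text \<open>\<open>f\<close> lists the successive derivatives of \<open>f 0\<close>. By compactness
  \<open>f (Suc n)\<close> is bounded on a smaller closed disk, so the remainder is of order
  \<open>norm z ^ Suc n\<close>.\<close>

lemma taylor_remainder_tendsto_0:
  fixes f :: "nat \<Rightarrow> complex \<Rightarrow> complex"
  assumes "r > 0"
    and deriv: "\<And>i w. w \<in> ball 0 r \<Longrightarrow> (f i has_field_derivative f (Suc i) w) (at w)"
  shows "((\<lambda>z. (f 0 z - (\<Sum>i\<le>n. f i 0 * z ^ i / fact i)) / z ^ n) \<longlongrightarrow> 0) (at 0)"
proof -
  have sub: "cball 0 (r/2) \<subseteq> ball (0::complex) r" using assms(1) by auto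
  have "continuous_on (cball 0 (r/2)) (f (Suc n))"
    by (rule DERIV_continuous_on) (use deriv sub has_field_derivative_at_within in blast)
  then have "bounded (f (Suc n) ` cball 0 (r/2))"
    by (intro compact_imp_bounded compact_continuous_image) auto
  then obtain B where B: "\<And>w. w \<in> cball 0 (r/2) \<Longrightarrow> norm (f (Suc n) w) \<le> B"
    unfolding bounded_iff by blast
  have bound: "norm (f 0 z - (\<Sum>i\<le>n. f i 0 * z ^ i / fact i)) \<le> B * norm z ^ Suc n / fact n"
    if "z \<in> cball 0 (r/2)" for z
    using complex_Taylor[of "cball 0 (r/2)" n f B 0 z] deriv sub B that assms(1)
    by (auto simp: has_field_derivative_at_within subset_iff)
  show ?thesis
  proof (rule Lim_null_comparison)
    show "\<forall>\<^sub>F z in at 0. norm ((f 0 z - (\<Sum>i\<le>n. f i 0 * z ^ i / fact i)) / z ^ n)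
        \<le> B / fact n * norm z"
      unfolding eventually_at
    proof (intro exI[of _ "r/2"] conjI ballI impI)
      fix z :: complex assume z: "z \<noteq> 0 \<and> dist z 0 < r / 2"
      then have "norm (f 0 z - (\<Sum>i\<le>n. f i 0 * z ^ i / fact i)) / norm z ^ n
          \<le> B * norm z ^ Suc n / fact n / norm z ^ n"
        by (intro divide_right_mono bound) auto
      also have "\<dots> = B / fact n * norm z" using z by simp
      finally show "norm ((f 0 z - (\<Sum>i\<le>n. f i 0 * z ^ i / fact i)) / z ^ n)
          \<le> B / fact n * norm z"
        by (simp add: norm_divide norm_power)
    qed (use assms in auto)
    show "((\<lambda>z. B / fact n * norm z) \<longlongrightarrow> 0) (at (0::complex))"
      by (auto intro!: tendsto_eq_intros)
  qed
qed

lemma connected_Compl_countable: "countable A \<Longrightarrow> connected (- A :: complex set)"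
  using connected_open_diff_countable[of UNIV A] by (simp add: Compl_eq_Diff_UNIV connected_UNIV)

context half_plane_point
begin

lemma add_pt_neq_0: "z \<notin> range pt \<Longrightarrow> z + pt p \<noteq> 0"
  by (metis add_eq_0_iff2 pt_minus range_eqI)

lemma add_pt_in_range_iff: "z + pt q \<in> range pt \<longleftrightarrow> z \<in> range pt"
proof
  assume "z + pt q \<in> range pt"
  then obtain p where "z + pt q = pt p" by auto
  then have "z = pt (p - q)" by (simp add: pt_diff algebra_simps)
  then show "z \<in> range pt" by simp
qed (auto simp flip: pt_add)

lemma open_Compl_lattice: "open (- range pt)"
proof (rule openI)
  fix z assume "z \<in> - range pt"
  then obtain c r where c: "c > 0" "r > 0"
    "\<And>w p. w \<in> ball z r \<Longrightarrow> p \<in> UNIV \<Longrightarrow> c * height p \<le> norm (w + pt p)"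
    using local_lower_bound[of UNIV z] add_pt_neq_0 by (metis ComplD)
  have "w \<notin> range pt" if "w \<in> ball z r" for w
  proof
    assume "w \<in> range pt"
    then obtain p where "w + pt (- p) = 0" by (auto simp: pt_minus)
    then show False using c(3)[OF that, of "- p"] c(1) height_ge_1[of "- p"]
      by (simp add: mult_le_0_iff)
  qed
  then show "\<exists>r>0. ball z r \<subseteq> - range pt" using c(2) by blast
qed

lemma origin_nbhd:
  obtains r where "r > 0" "\<And>z p. z \<in> ball 0 r \<Longrightarrow> p \<noteq> 0 \<Longrightarrow> z + pt p \<noteq> 0"
    "\<And>z. z \<in> ball 0 r \<Longrightarrow> z \<noteq> 0 \<Longrightarrow> z \<notin> range pt"
proof -
  obtain c r where c: "c > 0" "r > 0"
    "\<And>w p. w \<in> ball 0 r \<Longrightarrow> p \<in> -{0} \<Longrightarrow> c * height p \<le> norm (w + pt p)"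
    using local_lower_bound[of "-{0}" 0] pt_eq_0_iff
    by (metis ComplD add_0 singletonI)
  have nz: "z + pt p \<noteq> 0" if "z \<in> ball 0 r" "p \<noteq> 0" for z p
  proof -
    have "0 < c * height p" using c(1) height_ge_1[of p] by simp
    also have "\<dots> \<le> norm (z + pt p)" using c(3) that by blast
    finally show ?thesis by simp
  qed
  have "z \<notin> range pt" if "z \<in> ball 0 r" "z \<noteq> 0" for z
  proof
    assume "z \<in> range pt"
    then obtain p where "z = pt p" by auto
    then show False using nz[OF that(1), of "- p"] that(2) pt_eq_0_iff[of p] by (simp add: pt_minus)
  qed
  then show ?thesis using that c(2) nz by blast
qed

lemma eventually_off_lattice: "\<forall>\<^sub>F z in at 0. z \<notin> range pt"
proof -
  obtain r where "r > 0" "\<And>z. z \<in> ball 0 r \<Longrightarrow> z \<noteq> 0 \<Longrightarrow> z \<notin> range pt"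
    by (rule origin_nbhd) blast
  then show ?thesis unfolding eventually_at by (intro exI[of _ r]) auto
qed

lemma wp_deriv:
  assumes "z \<notin> range pt"
  shows "(wp has_field_derivative - 2 * E UNIV 3 z) (at z)"
proof -
  have "z \<noteq> 0" using assms pt_0 by (metis rangeI)
  have "((\<lambda>z. 1 / (z + 0)\<^sup>2 + R z) has_field_derivative
      (- of_nat 2 * (1 / (z + 0) ^ Suc 2) + - 2 * E (-{0}) 3 z)) (at z)"
    by (intro DERIV_add DERIV_inverse_shift_power R_deriv add_pt_neq_0)
       (use \<open>z \<noteq> 0\<close> assms in auto)
  moreover have "- of_nat 2 * (1 / (z + 0) ^ Suc 2) + - 2 * E (-{0}) 3 z = - 2 * E UNIV 3 z"
    using E_UNIV_eq[of z 3] add_pt_neq_0[OF assms] by (simp add: numeral_3_eq_3 numeral_2_eq_2)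
  ultimately show ?thesis by (simp add: wp_def[abs_def])
qed

lemma E_UNIV_deriv:
  assumes "z \<notin> range pt" "k \<ge> 3"
  shows "(E UNIV k has_field_derivative - of_nat k * E UNIV (Suc k) z) (at z)"
  using E_deriv[of UNIV z k] add_pt_neq_0 assms by blast

lemma wp_holomorphic: "wp holomorphic_on - range pt"
  using wp_deriv open_Compl_lattice by (auto simp: holomorphic_on_open)

lemma E_holomorphic: "k \<ge> 3 \<Longrightarrow> E UNIV k holomorphic_on - range pt"
  using E_UNIV_deriv open_Compl_lattice unfolding holomorphic_on_open[OF open_Compl_lattice] by blast

text \<open>
  The difference \<open>wp (z + pt q) - wp z\<close> is constant, and since \<open>wp\<close> is even it vanishes at
  \<open>z = - pt q / 2\<close>. This point is a pole when \<open>q\<close> is divisible by 2, so such \<open>q\<close> are first shifted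
  by a basis vector.
\<close>

lemma wp_periodic:
  assumes z: "z \<notin> range pt"
  shows "wp (z + pt q) = wp z"
proof -
  have step: "wp (z + pt q) = wp z" if q: "\<And>q'. q \<noteq> q' + q'" and z: "z \<notin> range pt" for q z
  proof -
    let ?d = "\<lambda>z. wp (z + pt q) - wp z"
    have half: "- pt q / 2 \<notin> range pt"
    proof
      assume "- pt q / 2 \<in> range pt"
      then obtain p where "- pt q / 2 = pt p" by auto
      then have "- pt q = 2 * pt p" by (simp add: field_simps)
      then have "pt q = - (2 * pt p)" by (metis minus_minus)
      then have "pt q = - pt p - pt p" by simp
      then have "pt q = pt (- p + - p)" by (simp only: pt_add pt_minus diff_conv_add_uminus)
      then show False using q pt_inj by blast
    qed
    have "(?d has_field_derivative 0) (at w)" if "w \<notin> range pt" for w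
    proof -
      have "((\<lambda>z. wp (z + pt q)) has_field_derivative - 2 * E UNIV 3 (w + pt q)) (at w)"
        using wp_deriv[of "w + pt q"] that by (simp add: DERIV_shift add_pt_in_range_iff)
      from DERIV_diff[OF this wp_deriv[OF that]] show ?thesis by (simp add: E_shift)
    qed
    then have "?d constant_on (- range pt)"
      by (intro DERIV_zero_connected_constant_on[of _ "{}"] open_Compl_lattice
            connected_Compl_countable DERIV_continuous_on[where D = "\<lambda>_. 0"])
         (auto intro: has_field_derivative_at_within)
    then obtain c where c: "\<And>w. w \<notin> range pt \<Longrightarrow> ?d w = c"
      unfolding constant_on_def by auto
    have "c = 0" using c[OF half] wp_uminus[of "pt q / 2"] by (simp add: field_simps)
    then show ?thesis using c[OF z] by simp
  qed
  show ?thesis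
  proof (cases "\<exists>q'. q = q' + q'")
    case False then show ?thesis using step z by blast
  next
    case True
    then obtain a b where q: "q = (a + a, b + b)" by (metis prod.collapse plus_prod_def)
    have 1: "(1, 0) \<noteq> q' + q'" "(a + a, b + b) + (1, 0) \<noteq> q' + q'" for q' :: "int \<times> int"
      by (cases q'; simp; presburger)+
    have "wp (z + pt q) = wp (z + pt q + pt (1, 0))"
      by (rule step[symmetric]) (use 1 z in \<open>auto simp: add_pt_in_range_iff\<close>)
    also have "\<dots> = wp (z + pt (q + (1, 0)))" by (simp add: pt_add add.assoc)
    also have "\<dots> = wp z" unfolding q by (rule step[OF 1(2) z])
    finally show ?thesis .
  qed
qed

text \<open>Setting the value 0 at all lattice points gives an entire function: the singularity at
  the origin is removable, and periodicity carries this to the other lattice points. Its values on a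
  compact period parallelogram bound it everywhere, so Liouville's theorem applies.\<close>

lemma periodic_eq_0:
  assumes holo: "F holomorphic_on - range pt"
    and per: "\<And>z q. z \<notin> range pt \<Longrightarrow> F (z + pt q) = F z"
    and lim: "(F \<longlongrightarrow> 0) (at 0)"
    and z: "z \<notin> range pt"
  shows "F z = 0"
proof -
  define H where "H z = (if z \<in> range pt then 0 else F z)" for z
  have per': "H (z + pt q) = H z" for z q
    using per by (simp add: H_def add_pt_in_range_iff)
  have H_holo: "H holomorphic_on - range pt"
    by (rule holomorphic_transform[OF holo]) (simp add: H_def)
  obtain r where r: "r > 0" "\<And>z. z \<in> ball 0 r \<Longrightarrow> z \<noteq> 0 \<Longrightarrow> z \<notin> range pt"
    by (rule origin_nbhd) blast
  have "(H \<longlongrightarrow> 0) (at 0)" (is ?lim)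
    by (rule Lim_transform_eventually[OF lim])
       (rule eventually_mono[OF eventually_off_lattice], simp add: H_def)
  have H0: "H 0 = 0" using pt_0 by (metis H_def rangeI)
  have "H holomorphic_on (ball 0 r - {0})"
    by (rule holomorphic_on_subset[OF H_holo]) (use r(2) in blast)
  then have "H holomorphic_on ball 0 r"
  proof (rule no_isolated_singularity'[of "{0}", rotated])
    fix w :: complex assume "w \<in> {0}"
    then show "(H \<longlongrightarrow> H w) (at w within ball 0 r)"
      using \<open>?lim\<close> H0 by (auto intro: tendsto_within_subset)
  qed auto
  then have 0: "H field_differentiable at 0"
    using r(1) by (simp add: holomorphic_on_imp_differentiable_at)
  have "H field_differentiable at w" for w
  proof (cases "w \<in> range pt")
    case True
    then obtain q where w: "w = pt q" by auto
    have "(\<lambda>z. H (z + - pt q)) field_differentiable at w"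
      unfolding field_differentiable_def
      using 0 DERIV_shift[of H _ w "- pt q"] by (auto simp: w field_differentiable_def)
    moreover have "(\<lambda>z. H (z + - pt q)) = H"
      using per'[of _ "- q"] by (simp add: pt_minus)
    ultimately show ?thesis by simp
  next
    case False
    then show ?thesis
      using H_holo open_Compl_lattice by (simp add: holomorphic_on_imp_differentiable_at)
  qed
  then have entire: "H holomorphic_on UNIV"
    by (simp add: holomorphic_on_def)
  \<comment> \<open>The closed period parallelogram; subtracting integer parts of the real
    coordinates moves any point into it.\<close>
  define K where "K = (\<lambda>(a, b). of_real a * \<tau> + of_real b) ` ({0..1::real} \<times> {0..1::real})"
  have "compact K" unfolding K_def
    by (intro compact_continuous_image compact_Times)
       (auto simp: case_prod_unfold intro!: continuous_intros)
  then have bd: "bounded (H ` K)"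
    by (intro compact_imp_bounded compact_continuous_image
          holomorphic_on_imp_continuous_on[OF holomorphic_on_subset[OF entire]]) auto
  have "range H \<subseteq> H ` K"
  proof safe
    fix w
    define a where "a = Im w / Im \<tau>"
    define b where "b = Re w - a * Re \<tau>"
    have w: "w = of_real a * \<tau> + of_real b"
      using Im_pos by (simp add: complex_eq_iff a_def b_def)
    have "w + pt (- \<lfloor>a\<rfloor>, - \<lfloor>b\<rfloor>) = of_real (frac a) * \<tau> + of_real (frac b)"
      by (simp add: w pt_def frac_def algebra_simps)
    also have "\<dots> \<in> K" unfolding K_def
      by (rule image_eqI[of _ _ "(frac a, frac b)"]) (auto simp: frac_lt_1 less_imp_le)
    finally show "H w \<in> H ` K" using per' by (metis imageI)
  qed
  then have "bounded (range H)" using bd bounded_subset by blast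
  then have "H constant_on UNIV" using entire Liouville_theorem by blast
  then have "H z = H 0" unfolding constant_on_def by auto
  then show ?thesis using z H0 by (simp add: H_def)
qed

abbreviation G4 :: complex where "G4 \<equiv> eisenstein_G 4 \<tau>"
abbreviation G6 :: complex where "G6 \<equiv> eisenstein_G 6 \<tau>"

lemma E_nonzero_0_odd: "odd k \<Longrightarrow> E (-{0}) k 0 = 0"
  using E_uminus[OF uminus_image_nonzero, of k 0] by simp

text \<open>The Taylor coefficients of \<open>R\<close> at 0 are multiples of Eisenstein series, and
  those of odd index vanish by symmetry. Order 5 for \<open>R\<close> and order 4 for its derivative
  suffice for the pole cancellations below.\<close>

lemma R_expansion:
  obtains S T where "(S \<longlongrightarrow> 0) (at 0)" "(T \<longlongrightarrow> 0) (at 0)"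
    "\<And>z. z \<noteq> 0 \<Longrightarrow> R z = 3 * G4 * z ^ 2 + 5 * G6 * z ^ 4 + z ^ 5 * S z"
    "\<And>z. z \<noteq> 0 \<Longrightarrow> E (-{0}) 3 z = - 3 * G4 * z - 10 * G6 * z ^ 3 + z ^ 4 * T z"
proof -
  obtain r where r: "r > 0" "\<And>z p. z \<in> ball 0 r \<Longrightarrow> p \<noteq> 0 \<Longrightarrow> z + pt p \<noteq> 0"
    by (rule origin_nbhd) blast
  \<comment> \<open>The tower of derivatives of \<open>R\<close>. The entry 0 is separate because
    the plain series with exponent 2 does not converge absolutely.\<close>
  define f where "f i = (if i = 0 then R else
    (\<lambda>z. (-1) ^ i * fact (Suc i) * E (-{0}) (i + 2) z))" for i
  have f: "(f i has_field_derivative f (Suc i) w) (at w)" if w: "w \<in> ball 0 r" for i w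
  proof (cases "i = 0")
    case True
    then show ?thesis using R_deriv[of w] r(2)[OF w] by (simp add: f_def numeral_3_eq_3)
  next
    case False
    have "((\<lambda>z. (-1) ^ i * fact (Suc i) * E (-{0}) (i + 2) z) has_field_derivative
      (-1) ^ i * fact (Suc i) * (- of_nat (i + 2) * E (-{0}) (Suc (i + 2)) w)) (at w)"
      by (intro DERIV_cmult E_deriv) (use r(2)[OF w] False in auto)
    then show ?thesis using False by (simp add: f_def algebra_simps)
  qed
  have v: "f 0 0 = 0" "f (Suc 0) 0 = 0" "f 2 0 = 6 * G4" "f 3 0 = 0" "f 4 0 = 120 * G6" "f 5 0 = 0"
    by (simp_all add: f_def eisenstein_G_eq E_nonzero_0_odd fact_numeral)
  define S where "S z = (f 0 z - (\<Sum>i\<le>5. f i 0 * z ^ i / fact i)) / z ^ 5" for z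
  \<comment> \<open>The factor \<open>- 1/2\<close> undoes the \<open>- 2\<close> in the derivative
    of \<open>R\<close>.\<close>
  define T where "T z = - 1/2 * ((f (Suc 0) z - (\<Sum>i\<le>4. f (Suc i) 0 * z ^ i / fact i)) / z ^ 4)" for z
  have "(S \<longlongrightarrow> 0) (at 0)" unfolding S_def
    by (rule taylor_remainder_tendsto_0[where f = f, OF r(1)]) (rule f)
  moreover have "(T \<longlongrightarrow> 0) (at 0)" unfolding T_def
    by (rule tendsto_mult_right_zero,
        rule taylor_remainder_tendsto_0[where f = "\<lambda>i. f (Suc i)", OF r(1)]) (rule f)
  moreover have "R z = 3 * G4 * z ^ 2 + 5 * G6 * z ^ 4 + z ^ 5 * S z" if "z \<noteq> 0" for z
  proof -
    have "(\<Sum>i\<le>5. f i 0 * z ^ i / fact i) = 3 * G4 * z ^ 2 + 5 * G6 * z ^ 4"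
    proof -
      have "{..5::nat} = {0, Suc 0, 2, 3, 4, 5}" by auto
      then show ?thesis by (simp add: v fact_numeral)
    qed
    moreover have "f 0 z = R z" by (simp add: f_def)
    ultimately show ?thesis using that by (simp add: S_def)
  qed
  moreover have "E (-{0}) 3 z = - 3 * G4 * z - 10 * G6 * z ^ 3 + z ^ 4 * T z" if "z \<noteq> 0" for z
  proof -
    have "(\<Sum>i\<le>4. f (Suc i) 0 * z ^ i / fact i) = 6 * G4 * z + 20 * G6 * z ^ 3"
    proof -
      have "{..4::nat} = {0, Suc 0, 2, 3, 4}" by auto
      moreover have "f (Suc (Suc 0)) 0 = 6 * G4" using v(3) by (simp only: numeral_2_eq_2)
      ultimately show ?thesis by (simp add: v fact_numeral)
    qed
    moreover have "f (Suc 0) z = - 2 * E (-{0}) 3 z" by (simp add: f_def numeral_3_eq_3)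
    ultimately have "T z = - 1/2 * ((- 2 * E (-{0}) 3 z - (6 * G4 * z + 20 * G6 * z ^ 3)) / z ^ 4)"
      by (simp only: T_def)
    then have "z ^ 4 * T z = E (-{0}) 3 z + (3 * G4 * z + 10 * G6 * z ^ 3)"
      using that by (simp, simp add: diff_divide_distrib add_divide_distrib)
    then show ?thesis by simp
  qed
  ultimately show ?thesis using that by blast
qed

subsection \<open>Differential equations and half periods\<close>

lemma R_tendsto_0: "(R \<longlongrightarrow> 0) (at 0)"
proof -
  have "isCont R 0" using R_deriv[of 0] pt_eq_0_iff by (auto intro: DERIV_isCont)
  then show ?thesis by (simp add: isCont_def)
qed

lemma E_nonzero_tendsto:
  assumes "k \<ge> 3"
  shows "(E (-{0}) k \<longlongrightarrow> E (-{0}) k 0) (at 0)"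
proof -
  have "isCont (E (-{0}) k) 0"
    using E_deriv[of "-{0}" 0 k] assms pt_eq_0_iff by (auto intro: DERIV_isCont)
  then show ?thesis by (simp add: isCont_def)
qed

text \<open>As \<open>wp'' = 6 * E UNIV 4\<close>, this is the second order differential equation of
  the Weierstrass function. The poles of order 4 cancel, and \<open>R z / z ^ 2\<close> tends to
  \<open>3 * G4\<close>, which fixes the constant.\<close>

lemma E_4_eq:
  assumes "z \<notin> range pt"
  shows "E UNIV 4 z = wp z ^ 2 - 5 * G4"
proof -
  obtain S T where S: "(S \<longlongrightarrow> 0) (at 0)"
    "\<And>z. z \<noteq> 0 \<Longrightarrow> R z = 3 * G4 * z ^ 2 + 5 * G6 * z ^ 4 + z ^ 5 * S z"
    using R_expansion by metis
  have "E UNIV 4 z - wp z ^ 2 + 5 * G4 = 0"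
  proof (rule periodic_eq_0[OF _ _ _ assms])
    show "(\<lambda>z. E UNIV 4 z - wp z ^ 2 + 5 * G4) holomorphic_on - range pt"
      by (intro holomorphic_intros E_holomorphic wp_holomorphic) auto
    show "E UNIV 4 (z + pt q) - wp (z + pt q) ^ 2 + 5 * G4 = E UNIV 4 z - wp z ^ 2 + 5 * G4"
      if "z \<notin> range pt" for z q
      using that by (simp add: E_shift wp_periodic)
    \<comment> \<open>The difference without its poles and with \<open>R z / z ^ 2\<close> expanded,
      so that every term has an evident limit.\<close>
    have "((\<lambda>z. E (-{0}) 4 z - 2 * (3 * G4 + 5 * G6 * z ^ 2 + z ^ 3 * S z) - R z ^ 2 + 5 * G4)
        \<longlongrightarrow> G4 - 2 * (3 * G4 + 5 * G6 * 0 ^ 2 + 0 ^ 3 * 0) - 0 ^ 2 + 5 * G4) (at 0)"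
      by (intro tendsto_intros S R_tendsto_0) (use E_nonzero_tendsto[of 4] in \<open>simp add: eisenstein_G_eq\<close>)
    then have "((\<lambda>z. E (-{0}) 4 z - 2 * (3 * G4 + 5 * G6 * z ^ 2 + z ^ 3 * S z) - R z ^ 2 + 5 * G4)
        \<longlongrightarrow> 0) (at 0)" by simp
    then show "((\<lambda>z. E UNIV 4 z - wp z ^ 2 + 5 * G4) \<longlongrightarrow> 0) (at 0)"
    proof (rule Lim_transform_eventually, use eventually_off_lattice in eventually_elim)
      fix z assume z: "z \<notin> range pt"
      have "z \<noteq> 0" using z pt_0 by (metis rangeI)
      then have R: "R z / z ^ 2 = 3 * G4 + 5 * G6 * z ^ 2 + z ^ 3 * S z"
        by (simp add: S(2) divide_simps) (simp add: algebra_simps eval_nat_numeral)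
      have "wp z ^ 2 = 1 / z ^ 4 + 2 * (R z / z ^ 2) + R z ^ 2"
        using \<open>z \<noteq> 0\<close> by (simp add: wp_def divide_simps) (simp add: algebra_simps eval_nat_numeral)
      moreover have "E UNIV 4 z = 1 / z ^ 4 + E (-{0}) 4 z"
        using E_UNIV_eq[of z 4] add_pt_neq_0[OF z] by simp
      ultimately show "E (-{0}) 4 z - 2 * (3 * G4 + 5 * G6 * z ^ 2 + z ^ 3 * S z) - R z ^ 2 + 5 * G4
          = E UNIV 4 z - wp z ^ 2 + 5 * G4"
        by (simp add: R)
    qed
  qed
  then show ?thesis by (simp add: algebra_simps)
qed

text \<open>Since \<open>wp' = - 2 * E UNIV 3\<close>, this is the classical first order equation
  divided by 4. The coefficients are those that cancel the poles of order 6 and 2 and the constant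
  term at the origin.\<close>

lemma E_3_squared_eq:
  assumes "z \<notin> range pt"
  shows "E UNIV 3 z ^ 2 = wp z ^ 3 - 15 * G4 * wp z - 35 * G6"
proof -
  obtain S T where ST: "(S \<longlongrightarrow> 0) (at 0)" "(T \<longlongrightarrow> 0) (at 0)"
    "\<And>z. z \<noteq> 0 \<Longrightarrow> R z = 3 * G4 * z ^ 2 + 5 * G6 * z ^ 4 + z ^ 5 * S z"
    "\<And>z. z \<noteq> 0 \<Longrightarrow> E (-{0}) 3 z = - 3 * G4 * z - 10 * G6 * z ^ 3 + z ^ 4 * T z"
    using R_expansion by blast
  let ?Q = "E (-{0}) 3"
  \<comment> \<open>What remains of the difference of both sides after the negative powers of
    \<open>z\<close> and the constants have cancelled; each summand tends to 0.\<close>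
  let ?F = "\<lambda>z. 2 * z * T z - 3 * z * S z + ?Q z ^ 2 - R z ^ 3 + 15 * G4 * R z
    - 3 * R z * (3 * G4 + 5 * G6 * z ^ 2 + z ^ 3 * S z)"
  have "E UNIV 3 z ^ 2 - wp z ^ 3 + 15 * G4 * wp z + 35 * G6 = 0"
  proof (rule periodic_eq_0[OF _ _ _ assms])
    show "(\<lambda>z. E UNIV 3 z ^ 2 - wp z ^ 3 + 15 * G4 * wp z + 35 * G6) holomorphic_on - range pt"
      by (intro holomorphic_intros E_holomorphic wp_holomorphic) auto
    show "E UNIV 3 (z + pt q) ^ 2 - wp (z + pt q) ^ 3 + 15 * G4 * wp (z + pt q) + 35 * G6 =
        E UNIV 3 z ^ 2 - wp z ^ 3 + 15 * G4 * wp z + 35 * G6"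
      if "z \<notin> range pt" for z q
      using that by (simp add: E_shift wp_periodic)
    have "(?Q \<longlongrightarrow> 0) (at 0)" using E_nonzero_tendsto[of 3] E_nonzero_0_odd[of 3] by simp
    then have "(?F \<longlongrightarrow> 2 * 0 * 0 - 3 * 0 * 0 + 0 ^ 2 - 0 ^ 3 + 15 * G4 * 0
        - 3 * 0 * (3 * G4 + 5 * G6 * 0 ^ 2 + 0 ^ 3 * 0)) (at 0)"
      by (intro tendsto_intros ST R_tendsto_0)
    then have "(?F \<longlongrightarrow> 0) (at 0)" by simp
    then show "((\<lambda>z. E UNIV 3 z ^ 2 - wp z ^ 3 + 15 * G4 * wp z + 35 * G6) \<longlongrightarrow> 0) (at 0)"
    proof (rule Lim_transform_eventually, use eventually_off_lattice in eventually_elim)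
      fix z assume z: "z \<notin> range pt"
      have nz: "z \<noteq> 0" using z pt_0 by (metis rangeI)
      have R2: "R z / z ^ 2 = 3 * G4 + 5 * G6 * z ^ 2 + z ^ 3 * S z"
        using nz by (simp add: ST(3) divide_simps) (simp add: algebra_simps eval_nat_numeral)
      have R4: "R z / z ^ 4 = 3 * G4 / z ^ 2 + 5 * G6 + z * S z"
        using nz by (simp add: ST(3) divide_simps) (simp add: algebra_simps eval_nat_numeral)
      have Q: "?Q z / z ^ 3 = - 3 * G4 / z ^ 2 - 10 * G6 + z * T z"
        using nz by (simp add: ST(4) divide_simps) (simp add: algebra_simps eval_nat_numeral)
      have "wp z ^ 3 = 1 / z ^ 6 + 3 * (R z / z ^ 4) + 3 * R z * (R z / z ^ 2) + R z ^ 3"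
        using nz by (simp add: wp_def divide_simps) (simp add: algebra_simps eval_nat_numeral)
      moreover have "E UNIV 3 z ^ 2 = 1 / z ^ 6 + 2 * (?Q z / z ^ 3) + ?Q z ^ 2"
      proof -
        have "E UNIV 3 z = 1 / z ^ 3 + ?Q z"
          using E_UNIV_eq[of z 3] add_pt_neq_0[OF z] by simp
        moreover have "(1 / z ^ 3 + w) ^ 2 = 1 / z ^ 6 + 2 * (w / z ^ 3) + w ^ 2" for w
          using nz by (simp add: divide_simps) (simp add: algebra_simps eval_nat_numeral)
        ultimately show ?thesis by simp
      qed
      moreover have "15 * G4 * wp z = 15 * G4 / z ^ 2 + 15 * G4 * R z"
        by (simp add: wp_def algebra_simps)
      ultimately show "?F z = E UNIV 3 z ^ 2 - wp z ^ 3 + 15 * G4 * wp z + 35 * G6"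
        unfolding R2 R4 Q by (simp add: algebra_simps)
    qed
  qed
  then show ?thesis by (simp add: algebra_simps)
qed

text \<open>Differentiating the formula for \<open>E UNIV 4\<close> gives -4 times each
  side.\<close>

lemma E_5_eq:
  assumes z: "z \<notin> range pt"
  shows "E UNIV 5 z = wp z * E UNIV 3 z"
proof -
  have "(E UNIV 4 has_field_derivative - of_nat 4 * E UNIV (Suc 4) z) (at z)"
    by (rule E_UNIV_deriv[OF z]) simp
  moreover have "(E UNIV 4 has_field_derivative 2 * wp z * (- 2 * E UNIV 3 z)) (at z)"
  proof (rule has_field_derivative_transform_within_open[OF _ open_Compl_lattice])
    show "((\<lambda>z. wp z ^ 2 - 5 * G4) has_field_derivative 2 * wp z * (- 2 * E UNIV 3 z)) (at z)"
      by (rule derivative_eq_intros wp_deriv[OF z] refl | simp)+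
  qed (use z E_4_eq in auto)
  ultimately show ?thesis using DERIV_unique by fastforce
qed

text \<open>This is the derivative of \<open>E UNIV 5 z = wp z * E UNIV 3 z\<close>.\<close>

lemma E_6_eq:
  assumes z: "z \<notin> range pt"
  shows "5 * E UNIV 6 z = 2 * E UNIV 3 z ^ 2 + 3 * wp z * E UNIV 4 z"
proof -
  have "(E UNIV 5 has_field_derivative - of_nat 5 * E UNIV (Suc 5) z) (at z)"
    by (rule E_UNIV_deriv[OF z]) simp
  moreover have "(E UNIV 5 has_field_derivative
      wp z * (- of_nat 3 * E UNIV (Suc 3) z) + - 2 * E UNIV 3 z * E UNIV 3 z) (at z)"
  proof (rule has_field_derivative_transform_within_open[OF _ open_Compl_lattice])
    show "((\<lambda>z. wp z * E UNIV 3 z) has_field_derivative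
        wp z * (- of_nat 3 * E UNIV (Suc 3) z) + - 2 * E UNIV 3 z * E UNIV 3 z) (at z)"
      by (intro DERIV_mult' wp_deriv E_UNIV_deriv z) simp
  qed (use z E_5_eq in auto)
  ultimately have "- of_nat 5 * E UNIV (Suc 5) z =
      wp z * (- of_nat 3 * E UNIV (Suc 3) z) + - 2 * E UNIV 3 z * E UNIV 3 z"
    by (rule DERIV_unique)
  then show ?thesis by (simp add: algebra_simps power2_eq_square)
qed

text \<open>\<open>E UNIV 3\<close> is odd and periodic, while \<open>h\<close> and
  \<open>- h\<close> differ by a lattice point.\<close>

lemma E_3_half_period:
  assumes "2 * h = pt q"
  shows "E UNIV 3 h = 0"
proof -
  have "E UNIV 3 (- h) = E UNIV 3 (- h + pt q)" by (simp only: E_shift)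
  also have "- h + pt q = h" by (simp flip: assms)
  finally show ?thesis using E_uminus[of UNIV 3 h] by (simp add: bij_uminus bij_is_surj)
qed

text \<open>Where \<open>E UNIV 3\<close> vanishes, the differential equations become algebraic; the
  last one makes \<open>wp h\<close> a root of the Weierstrass cubic.\<close>

lemma half_period_values:
  assumes "h \<notin> range pt" "2 * h = pt q"
  shows "E UNIV 4 h = wp h ^ 2 - 5 * G4"
    and "5 * E UNIV 6 h = 3 * wp h * (wp h ^ 2 - 5 * G4)"
    and "wp h ^ 3 = 15 * G4 * wp h + 35 * G6"
proof -
  note * = E_3_half_period[OF assms(2)]
  show "E UNIV 4 h = wp h ^ 2 - 5 * G4" by (rule E_4_eq) fact
  then show "5 * E UNIV 6 h = 3 * wp h * (wp h ^ 2 - 5 * G4)"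
    using E_6_eq[OF assms(1)] * by simp
  show "wp h ^ 3 = 15 * G4 * wp h + 35 * G6"
    using E_3_squared_eq[OF assms(1)] * by (simp add: algebra_simps)
qed

text \<open>
  If \<open>wp\<close> took the same value at two half periods, its translates by them would solve
  \<open>f'' = 6 f\<^sup>2 - 30 G4\<close> with equal initial data at \<open>0\<close>, because \<open>wp'\<close> vanishes at half periods. They would
  therefore coincide, although their poles are different.
\<close>

lemma wp_half_period_neq:
  assumes h: "h1 \<notin> range pt" "h2 \<notin> range pt" "h2 - h1 \<notin> range pt"
    and q: "2 * h1 = pt q1" "2 * h2 = pt q2"
  shows "wp h1 \<noteq> wp h2"
proof
  assume eq: "wp h1 = wp h2"
  define U where "U = {z. z + h1 \<notin> range pt \<and> z + h2 \<notin> range pt}"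
  define d where "d z = wp (z + h1) - wp (z + h2)" for z
  define d' where "d' z = - 2 * E UNIV 3 (z + h1) - - 2 * E UNIV 3 (z + h2)" for z
  \<comment> \<open>Subtracting the two equations and factoring the difference of squares gives the
    linear equation \<open>d'' = g * d\<close>.\<close>
  define g where "g z = 6 * (wp (z + h1) + wp (z + h2))" for z
  have "U = (\<lambda>z. z + h1) -` (- range pt) \<inter> (\<lambda>z. z + h2) -` (- range pt)"
    by (auto simp: U_def)
  then have U: "open U"
    by (auto intro!: open_Int open_vimage open_Compl_lattice continuous_intros)
  have "U = - (range (\<lambda>p. pt p - h1) \<union> range (\<lambda>p. pt p - h2))"
  proof -
    have "z \<in> range (\<lambda>p. pt p - h) \<longleftrightarrow> z + h \<in> range pt" for z h
      by (auto simp only: image_iff eq_diff_eq)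
    then show ?thesis unfolding U_def by blast
  qed
  then have conn: "connected U"
    by (simp only:) (intro connected_Compl_countable countable_Un countable_image; simp)
  have 0: "0 \<in> U" using h by (simp add: U_def)
  have d1: "(d has_field_derivative d' z) (at z)" if "z \<in> U" for z
  proof -
    have "((\<lambda>z. wp (z + h)) has_field_derivative - 2 * E UNIV 3 (z + h)) (at z)"
      if "z + h \<notin> range pt" for h
      using wp_deriv[OF that] by (simp add: DERIV_shift)
    then show ?thesis
      unfolding d_def d'_def using that by (intro DERIV_diff) (auto simp only: U_def mem_Collect_eq)
  qed
  have d2: "(d' has_field_derivative g z * d z) (at z)" if "z \<in> U" for z
  proof -
    have E': "((\<lambda>z. E UNIV 3 (z + h)) has_field_derivative - of_nat 3 * E UNIV (Suc 3) (z + h)) (at z)"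
      if "z + h \<notin> range pt" for h
      using E_UNIV_deriv[OF that, of 3] by (simp add: DERIV_shift)
    have "(d' has_field_derivative - 2 * (- of_nat 3 * E UNIV (Suc 3) (z + h1))
        - - 2 * (- of_nat 3 * E UNIV (Suc 3) (z + h2))) (at z)"
      unfolding d'_def using that by (intro DERIV_diff DERIV_cmult E') (auto simp: U_def)
    moreover have "- 2 * (- of_nat 3 * E UNIV (Suc 3) (z + h1))
        - - 2 * (- of_nat 3 * E UNIV (Suc 3) (z + h2)) = g z * d z"
      using that by (simp add: U_def E_4_eq g_def d_def power2_eq_square algebra_simps)
    ultimately show ?thesis by simp
  qed
  have holo: "d holomorphic_on U" using d1 U by (auto simp: holomorphic_on_open)
  have wp': "(\<lambda>z. wp (z + h)) holomorphic_on U" if "\<And>z. z \<in> U \<Longrightarrow> z + h \<notin> range pt" for h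
    by (rule holomorphic_on_compose_gen[OF _ wp_holomorphic, unfolded o_def])
       (use that in \<open>auto intro!: holomorphic_intros\<close>)
  have gholo: "g holomorphic_on U" unfolding g_def
    by (intro holomorphic_intros wp') (auto simp: U_def)
  have dd: "deriv (deriv d) z = g z * d z" if "z \<in> U" for z
  proof -
    have "(deriv d has_field_derivative g z * d z) (at z)"
      by (rule has_field_derivative_transform_within_open[OF d2[OF that] U that])
         (rule DERIV_imp_deriv[OF d1, symmetric])
    then show ?thesis by (rule DERIV_imp_deriv)
  qed
  \<comment> \<open>Orders 0 and 1 are the initial data; higher orders follow from the Leibniz rule
    for \<open>g * d\<close>.\<close>
  have "(deriv ^^ n) d 0 = 0" for n
  proof (induction n rule: less_induct)
    case (less n)
    consider "n = 0" | "n = 1" | m where "n = m + 2"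
      by (metis One_nat_def Suc_1 add_2_eq_Suc' not0_implies_Suc)
    then show ?case
    proof cases
      case 1 then show ?thesis by (simp add: d_def eq)
    next
      case 2
      have "d' 0 = 0" using E_3_half_period q by (simp add: d'_def)
      then show ?thesis using 2 d1[OF 0] by (simp add: DERIV_imp_deriv)
    next
      case 3
      have "(deriv ^^ n) d 0 = (deriv ^^ m) (deriv (deriv d)) 0"
        by (simp add: 3 numeral_2_eq_2 funpow_Suc_right del: funpow.simps)
      also have "\<dots> = (deriv ^^ m) (\<lambda>z. g z * d z) 0"
        using dd U 0 by (intro higher_deriv_cong_ev) (auto simp: eventually_nhds)
      also have "\<dots> = (\<Sum>i = 0..m. of_nat (m choose i) * (deriv ^^ i) g 0 * (deriv ^^ (m - i)) d 0)"
        by (rule higher_deriv_mult[OF gholo holo U 0])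
      also have "\<dots> = 0" using less by (intro sum.neutral) (auto simp: 3)
      finally show ?thesis .
    qed
  qed
  then have d0: "d z = 0" if "z \<in> U" for z
    using holomorphic_fun_eq_0_on_connected[OF holo U conn _ 0 that] by blast
  define k where "k = h2 - h1"
  have k: "k \<notin> range pt" using h by (simp add: k_def)
  have "isCont wp k" using wp_deriv[OF k] by (rule DERIV_isCont)
  then have lim: "((\<lambda>z. wp (z + k)) \<longlongrightarrow> wp k) (at 0)"
    by (simp add: isCont_def LIM_offset_zero_iff add.commute)
  have "open ((\<lambda>z. z + k) -` (- range pt))"
    by (intro open_vimage open_Compl_lattice continuous_intros)
  then have "\<forall>\<^sub>F z in at 0. z + k \<notin> range pt"
    unfolding eventually_at_topological
    by (intro exI[of _ "(\<lambda>z. z + k) -` (- range pt)"]) (use k in \<open>simp add: vimage_def\<close>)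
  \<comment> \<open>Since \<open>d\<close> vanishes, \<open>wp\<close> near \<open>k\<close> would
    repeat its double pole at 0: after multiplication by \<open>z ^ 2\<close> one side tends to 0,
    the other to 1.\<close>
  then have "\<forall>\<^sub>F z in at 0. z ^ 2 * wp (z + k) = 1 + z ^ 2 * R z"
    using eventually_off_lattice
  proof eventually_elim
    case (elim z)
    have "z \<noteq> 0" using elim(2) pt_0 by (metis rangeI)
    have "z - h1 \<in> U" using elim by (simp add: U_def k_def algebra_simps)
    then have "wp (z + k) = wp z" using d0[of "z - h1"] by (simp add: d_def k_def algebra_simps)
    then show ?case using \<open>z \<noteq> 0\<close> by (simp add: wp_def distrib_left)
  qed
  moreover have "((\<lambda>z. z ^ 2 * wp (z + k)) \<longlongrightarrow> 0 ^ 2 * wp k) (at 0)"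
    by (intro tendsto_intros lim)
  ultimately have "((\<lambda>z. 1 + z ^ 2 * R z) \<longlongrightarrow> 0 ^ 2 * wp k) (at 0)"
    by (rule Lim_transform_eventually[rotated])
  moreover have "((\<lambda>z. 1 + z ^ 2 * R z) \<longlongrightarrow> 1 + 0 ^ 2 * 0) (at (0::complex))"
    by (intro tendsto_intros R_tendsto_0)
  ultimately show False using tendsto_unique[of "at (0::complex)"] by fastforce
qed

end

subsection \<open>The j-invariant in terms of the roots of the Weierstrass cubic\<close>

definition isogenous_j :: "complex \<Rightarrow> complex" where
  "isogenous_j u = 16 * ((u + 1 / u + 14) ^ 3 / (u + 1 / u - 2) ^ 2)"

text \<open>The j-invariant of the Legendre curve
  \<open>y^2 = x * (x - 1) * (x - u)\<close>.\<close>

definition legendre_j :: "complex \<Rightarrow> complex" where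
  "legendre_j u = 256 * ((u ^ 2 - u + 1) ^ 3 / (u ^ 2 - u) ^ 2)"

lemma isogenous_j_inverse: "isogenous_j (1 / u) = isogenous_j u"
  by (simp add: isogenous_j_def add.commute)

text \<open>A form homogeneous of degree 0, suited to differences \<open>a\<close> and
  \<open>b\<close> of roots of the cubic.\<close>

lemma isogenous_j_divide:
  assumes "a \<noteq> 0" "b \<noteq> 0" "a \<noteq> b"
  shows "isogenous_j (a / b) = 16 * (a ^ 2 + b ^ 2 + 14 * a * b) ^ 3 / (a * b * (a - b) ^ 4)"
proof -
  define p where "p = a * b"
  have p: "p \<noteq> 0" "(a - b) ^ 4 \<noteq> 0" using assms by (auto simp: p_def)
  have "a / b + 1 / (a / b) + 14 = (a ^ 2 + b ^ 2 + 14 * a * b) / p"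
    "a / b + 1 / (a / b) - 2 = (a - b) ^ 2 / p"
    using assms by (simp_all add: p_def field_simps power2_eq_square)
  then have "isogenous_j (a / b) =
      16 * (((a ^ 2 + b ^ 2 + 14 * a * b) / p) ^ 3 / ((a - b) ^ 2 / p) ^ 2)"
    by (simp only: isogenous_j_def)
  also have "\<dots> = 16 * (a ^ 2 + b ^ 2 + 14 * a * b) ^ 3 / (p * (a - b) ^ 4)"
    using p by (simp add: power_divide divide_simps flip: power_mult)
      (simp add: power2_eq_square power3_eq_cube)
  finally show ?thesis by (simp add: p_def)
qed

lemma legendre_j_divide:
  assumes "a \<noteq> 0" "b \<noteq> 0" "a \<noteq> b"
  shows "legendre_j (a / b) = 256 * (a ^ 2 - a * b + b ^ 2) ^ 3 / (a * b * (a - b)) ^ 2"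
proof -
  have "(a / b) ^ 2 - a / b + 1 = (a ^ 2 - a * b + b ^ 2) / b ^ 2"
    "(a / b) ^ 2 - a / b = a * (a - b) / b ^ 2"
    using assms by (simp_all add: field_simps power2_eq_square)
  then have "legendre_j (a / b) =
      256 * (((a ^ 2 - a * b + b ^ 2) / b ^ 2) ^ 3 / (a * (a - b) / b ^ 2) ^ 2)"
    by (simp only: legendre_j_def)
  also have "\<dots> = 256 * (a ^ 2 - a * b + b ^ 2) ^ 3 / (a * b * (a - b)) ^ 2"
    using assms by (simp add: power_divide divide_simps flip: power_mult)
  finally show ?thesis .
qed

text \<open>Cross-multiplied, the equation splits into six factors linear in \<open>x\<close>, one
  for each element of the anharmonic group.\<close>

lemma legendre_j_eq_imp:
  assumes eq: "legendre_j x = legendre_j y"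
    and x: "x \<noteq> 0" "x \<noteq> 1" and y: "y \<noteq> 0" "y \<noteq> 1"
  shows "x \<in> {y, 1 - y, 1 / y, 1 / (1 - y), (y - 1) / y, y / (y - 1)}"
proof -
  have nz: "x ^ 2 - x \<noteq> 0" "y ^ 2 - y \<noteq> 0"
    using x y by (simp_all add: power2_eq_square)
  have "(x ^ 2 - x + 1) ^ 3 * (y ^ 2 - y) ^ 2 - (y ^ 2 - y + 1) ^ 3 * (x ^ 2 - x) ^ 2 = 0"
    using eq nz by (simp add: legendre_j_def divide_simps)
  moreover have "(x ^ 2 - x + 1) ^ 3 * (y ^ 2 - y) ^ 2 - (y ^ 2 - y + 1) ^ 3 * (x ^ 2 - x) ^ 2 =
      (x - y) * (x - (1 - y)) * (x * y - 1) * (x * (1 - y) - 1) * (x * y - (y - 1)) * (y - x * (y - 1))"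
    by (simp add: algebra_simps eval_nat_numeral)
  ultimately consider "x = y" | "x = 1 - y" | "x * y = 1" | "x * (1 - y) = 1" | "x * y = y - 1"
    | "x * (y - 1) = y"
    by auto
  then show ?thesis
  proof cases
    case 3 then show ?thesis using y by (simp add: eq_divide_eq)
  next
    case 4 then show ?thesis using y by (simp add: eq_divide_eq)
  next
    case 5 then show ?thesis using y by (simp add: eq_divide_eq)
  next
    case 6 then show ?thesis using y by (simp add: eq_divide_eq)
  qed auto
qed

text \<open>Each of the six substitutions permutes \<open>y\<close>, \<open>1 - y\<close> and
  \<open>(y - 1) / y\<close> up to inversion, under which \<open>isogenous_j\<close> is
  invariant.\<close>

lemma isogenous_j_orbit:
  assumes "legendre_j x = legendre_j y" "x \<noteq> 0" "x \<noteq> 1" "y \<noteq> 0" "y \<noteq> 1"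
  shows "{isogenous_j x, isogenous_j (1 - x), isogenous_j ((x - 1) / x)} =
         {isogenous_j y, isogenous_j (1 - y), isogenous_j ((y - 1) / y)}"
proof -
  have i: "isogenous_j u = isogenous_j v" if "u * v = 1" for u v
  proof -
    have "v = 1 / u" using that by (metis eq_divide_eq mult.commute mult_zero_left zero_neq_one)
    then show ?thesis by (simp add: isogenous_j_inverse)
  qed
  have y1: "1 - y \<noteq> 0" "y - 1 \<noteq> 0" using assms by auto
  from legendre_j_eq_imp[OF assms]
  consider "x = y" | "x = 1 - y" | "x = 1 / y" | "x = 1 / (1 - y)" | "x = (y - 1) / y"
    | "x = y / (y - 1)" by blast
  then show ?thesis
  proof cases
    case 2
    have "isogenous_j ((x - 1) / x) = isogenous_j ((y - 1) / y)"
      by (rule i) (use 2 assms y1 in \<open>simp add: field_simps\<close>)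
    then show ?thesis using 2 by auto
  next
    case 3
    have "1 - x = (y - 1) / y" "(x - 1) / x = 1 - y"
      using 3 assms y1 by (simp_all add: field_simps)
    moreover have "isogenous_j x = isogenous_j y"
      by (rule i) (use 3 assms in simp)
    ultimately show ?thesis by auto
  next
    case 4
    have "(x - 1) / x = y"
      using 4 assms y1 by (simp add: field_simps)
    moreover have "isogenous_j x = isogenous_j (1 - y)"
      by (rule i) (use 4 y1 in simp)
    moreover have "isogenous_j (1 - x) = isogenous_j ((y - 1) / y)"
      by (rule i) (use 4 assms y1 in \<open>simp add: field_simps\<close>)
    ultimately show ?thesis by auto
  next
    case 5
    have "isogenous_j (1 - x) = isogenous_j y"
      by (rule i) (use 5 assms in \<open>simp add: field_simps\<close>)
    moreover have "isogenous_j ((x - 1) / x) = isogenous_j (1 - y)"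
      by (rule i) (use 5 assms y1 in \<open>simp add: field_simps\<close>)
    ultimately show ?thesis using 5 by auto
  next
    case 6
    have "isogenous_j x = isogenous_j ((y - 1) / y)"
      by (rule i) (use 6 assms y1 in \<open>simp add: field_simps\<close>)
    moreover have "isogenous_j (1 - x) = isogenous_j (1 - y)"
      by (rule i) (use 6 assms y1 in \<open>simp add: field_simps\<close>)
    moreover have "isogenous_j ((x - 1) / x) = isogenous_j y"
      by (rule i) (use 6 assms y1 in \<open>simp add: field_simps\<close>)
    ultimately show ?thesis by auto
  qed simp
qed

lemma modular_j_eq_divide:
  assumes "60 * eisenstein_G 4 \<sigma> = x" "140 * eisenstein_G 6 \<sigma> = y"
  shows "modular_j \<sigma> = 1728 * x ^ 3 / (x ^ 3 - 27 * y ^ 2)"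
  using assms by (simp add: modular_j_def invariant_g2_def invariant_g3_def)

text \<open>Roots with sum zero are linear forms in the differences \<open>a\<close> and
  \<open>b\<close>, so the invariants become polynomials in \<open>a\<close> and
  \<open>b\<close>.\<close>

lemma modular_j_eq_legendre_j:
  assumes "e1 + e2 + e3 = 0" "e1 \<noteq> e2" "e1 \<noteq> e3" "e2 \<noteq> e3"
    and G4: "15 * eisenstein_G 4 \<tau> = e1 ^ 2 + e1 * e2 + e2 ^ 2"
    and G6: "35 * eisenstein_G 6 \<tau> = e1 * e2 * e3"
  shows "modular_j \<tau> = legendre_j ((e1 - e2) / (e1 - e3))"
proof -
  define a b where "a = e1 - e2" and "b = e1 - e3"
  have ab: "a \<noteq> 0" "b \<noteq> 0" "a \<noteq> b" using assms by (auto simp: a_def b_def)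
  have "e3 = - e1 - e2" using assms(1) by algebra
  then have e: "e1 = (a + b) / 3" "e2 = (b - 2 * a) / 3" "e3 = (a - 2 * b) / 3"
    by (simp_all add: a_def b_def)
  have g2: "60 * eisenstein_G 4 \<tau> = 4 / 3 * (a ^ 2 - a * b + b ^ 2)"
  proof -
    have "60 * eisenstein_G 4 \<tau> = 4 * (15 * eisenstein_G 4 \<tau>)" by simp
    also have "\<dots> = 4 / 3 * (a ^ 2 - a * b + b ^ 2)"
      unfolding G4 e by (simp add: field_simps power2_eq_square)
    finally show ?thesis .
  qed
  have g3: "140 * eisenstein_G 6 \<tau> = 4 / 27 * ((a + b) * (b - 2 * a) * (a - 2 * b))"
  proof -
    have "140 * eisenstein_G 6 \<tau> = 4 * (35 * eisenstein_G 6 \<tau>)" by simp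
    also have "\<dots> = 4 / 27 * ((a + b) * (b - 2 * a) * (a - 2 * b))"
      unfolding G6 e by (simp add: field_simps)
    finally show ?thesis .
  qed
  \<comment> \<open>The discriminant is 16 times the squared product of the root
    differences.\<close>
  have "(4 / 3 * (a ^ 2 - a * b + b ^ 2)) ^ 3
      - 27 * (4 / 27 * ((a + b) * (b - 2 * a) * (a - 2 * b))) ^ 2 = 16 * (a * b * (a - b)) ^ 2"
    by (simp add: field_simps eval_nat_numeral)
  then have "modular_j \<tau> = 1728 * (4 / 3 * (a ^ 2 - a * b + b ^ 2)) ^ 3 / (16 * (a * b * (a - b)) ^ 2)"
    using modular_j_eq_divide[OF g2 g3] by simp
  also have "\<dots> = 256 * (a ^ 2 - a * b + b ^ 2) ^ 3 / (a * b * (a - b)) ^ 2"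
  proof -
    have "1728 * (4 / 3 * w) ^ 3 / (16 * v) = 256 * w ^ 3 / v" for v w :: complex
      by (simp add: power_mult_distrib power_divide)
    then show ?thesis .
  qed
  finally show ?thesis using legendre_j_divide[OF ab] by (simp add: a_def b_def)
qed

text \<open>Numerator and denominator of the j-invariant both carry \<open>c ^ 12\<close>, so the
  scale cancels. \<open>g4\<close> and \<open>g6\<close> stand for the Eisenstein series of the
  original lattice.\<close>

lemma modular_j_eq_isogenous_j:
  assumes "e1 + e2 + e3 = 0" "e1 \<noteq> e2" "e1 \<noteq> e3" "e2 \<noteq> e3" "c \<noteq> 0"
    and g4: "15 * g4 = e1 ^ 2 + e1 * e2 + e2 ^ 2" and g6: "35 * g6 = e1 * e2 * e3"
    and G4: "eisenstein_G 4 \<sigma> = c ^ 4 * (e1 ^ 2 - 4 * g4)"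
    and G6: "5 * eisenstein_G 6 \<sigma> = c ^ 6 * (5 * g6 + 3 * e1 * (e1 ^ 2 - 5 * g4))"
  shows "modular_j \<sigma> = isogenous_j ((e1 - e2) / (e1 - e3))"
proof -
  define a b where "a = e1 - e2" and "b = e1 - e3"
  have ab: "a \<noteq> 0" "b \<noteq> 0" "a \<noteq> b" using assms by (auto simp: a_def b_def)
  have "e3 = - e1 - e2" using assms(1) by algebra
  then have e: "e1 = (a + b) / 3" "e2 = (b - 2 * a) / 3" "e3 = (a - 2 * b) / 3"
    by (simp_all add: a_def b_def)
  define X where "X = a ^ 2 + b ^ 2 + 14 * a * b"
  define Y where "Y = (a + b) * (34 * a * b - a ^ 2 - b ^ 2)"
  have g2: "60 * eisenstein_G 4 \<sigma> = c ^ 4 * (4 / 3 * X)"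
  proof -
    have "60 * eisenstein_G 4 \<sigma> = c ^ 4 * (60 * e1 ^ 2 - 16 * (15 * g4))"
      unfolding G4 by (simp add: algebra_simps)
    also have "60 * e1 ^ 2 - 16 * (15 * g4) = 4 / 3 * X"
      unfolding g4 e X_def by (simp add: field_simps power2_eq_square)
    finally show ?thesis .
  qed
  have g3: "140 * eisenstein_G 6 \<sigma> = c ^ 6 * (8 / 27 * Y)"
  proof -
    have "140 * eisenstein_G 6 \<sigma> = 28 * (5 * eisenstein_G 6 \<sigma>)" by simp
    also have "\<dots> = c ^ 6 * (4 * (35 * g6) + 84 * e1 ^ 3 - 28 * e1 * (15 * g4))"
      unfolding G6 by (simp add: algebra_simps power2_eq_square power3_eq_cube)
    also have "4 * (35 * g6) + 84 * e1 ^ 3 - 28 * e1 * (15 * g4) = 8 / 27 * Y"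
      unfolding g4 g6 e Y_def by (simp add: field_simps power2_eq_square power3_eq_cube)
    finally show ?thesis .
  qed
  \<comment> \<open>Up to a constant and a power of \<open>c\<close>, this is the discriminant of
    the superlattice.\<close>
  have XY: "X ^ 3 - Y ^ 2 = 108 * (a * b * (a - b) ^ 4)"
    unfolding X_def Y_def by (simp add: algebra_simps eval_nat_numeral)
  have "(c ^ 4 * (4 / 3 * X)) ^ 3 - 27 * (c ^ 6 * (8 / 27 * Y)) ^ 2 = c ^ 12 * (64 / 27) * (X ^ 3 - Y ^ 2)"
    by (simp add: power_mult_distrib power_divide algebra_simps flip: power_mult)
  also have "\<dots> = c ^ 12 * 256 * (a * b * (a - b) ^ 4)" unfolding XY by simp
  finally have "modular_j \<sigma> = 1728 * (c ^ 4 * (4 / 3 * X)) ^ 3 / (c ^ 12 * 256 * (a * b * (a - b) ^ 4))"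
    using modular_j_eq_divide[OF g2 g3] by simp
  also have "\<dots> = 16 * X ^ 3 / (a * b * (a - b) ^ 4)"
    using \<open>c \<noteq> 0\<close> by (simp add: power_mult_distrib power_divide flip: power_mult)
  finally show ?thesis using isogenous_j_divide[OF ab] by (simp add: X_def a_def b_def)
qed

subsection \<open>Lattices of index two\<close>

context half_plane_point
begin

text \<open>
  The lattice of \<open>\<sigma>\<close>, scaled by \<open>c\<close>, is the union of the lattice of \<open>\<tau>\<close> (parametrised by \<open>\<phi>\<close>) and of its
  translate by the half period \<open>h\<close> (parametrised by \<open>\<psi>\<close>).
\<close>

lemma eisenstein_G_index_two:
  fixes \<phi> \<psi> :: "int \<times> int \<Rightarrow> int \<times> int"
  assumes "inj \<phi>" "inj \<psi>" and disj: "\<And>p q. \<phi> p \<noteq> \<psi> q"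
    and cover: "\<And>x. x \<in> range \<phi> \<or> x \<in> range \<psi>"
    and "\<phi> 0 = 0" "c \<noteq> 0"
    and \<phi>: "\<And>p. (case \<phi> p of (m, n) \<Rightarrow> of_int m * \<sigma> + of_int n) = pt p / c"
    and \<psi>: "\<And>p. (case \<psi> p of (m, n) \<Rightarrow> of_int m * \<sigma> + of_int n) = (h + pt p) / c"
    and h: "h \<notin> range pt" and k: "k \<ge> 3"
  shows "eisenstein_G k \<sigma> = c ^ k * (eisenstein_G k \<tau> + E UNIV k h)"
proof -
  define f where "f = (\<lambda>(m, n). 1 / (of_int m * \<sigma> + of_int n) ^ k)"
  have f\<phi>: "f (\<phi> p) = c ^ k * (1 / (0 + pt p) ^ k)" for p
    using \<phi>[of p] by (simp add: f_def case_prod_unfold power_divide)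
  have f\<psi>: "f (\<psi> p) = c ^ k * (1 / (h + pt p) ^ k)" for p
    using \<psi>[of p] by (simp add: f_def case_prod_unfold power_divide)
  have inj: "inj_on \<phi> (-{0})" "inj \<psi>" using assms(1,2) by (auto intro: inj_on_subset)
  have s1: "f summable_on \<phi> ` (-{0})"
    unfolding summable_on_reindex[OF inj(1)] o_def f\<phi>
    by (intro summable_on_cmult_right E_summable) (use k pt_eq_0_iff in auto)
  have s2: "f summable_on range \<psi>"
    unfolding summable_on_reindex[OF inj(2)] o_def f\<psi>
    by (intro summable_on_cmult_right E_summable) (use k add_pt_neq_0[OF h] in auto)
  \<comment> \<open>The translate misses the origin, so only the first coset loses an index.\<close>
  have \<psi>0: "\<psi> p \<noteq> 0" for p using disj[of 0 p] \<open>\<phi> 0 = 0\<close> by auto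
  have \<phi>0: "\<phi> p = 0 \<longleftrightarrow> p = 0" for p using inj_eq[OF assms(1), of p 0] \<open>\<phi> 0 = 0\<close> by simp
  have "\<phi> ` (-{0}) \<union> range \<psi> = -{0}"
  proof (rule equalityI; rule subsetI)
    show "x \<in> -{0}" if "x \<in> \<phi> ` (-{0}) \<union> range \<psi>" for x
      using that \<phi>0 \<psi>0 by (auto simp del: split_paired_All)
    show "x \<in> \<phi> ` (-{0}) \<union> range \<psi>" if "x \<in> -{0}" for x
      using cover[of x] that \<phi>0 by fastforce
  qed
  then have "eisenstein_G k \<sigma> = infsum f (\<phi> ` (-{0}) \<union> range \<psi>)"
    unfolding eisenstein_G_def f_def by (simp add: Compl_eq_Diff_UNIV zero_prod_def)
  also have "\<dots> = infsum f (\<phi> ` (-{0})) + infsum f (range \<psi>)"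
  proof (rule infsum_Un_disjoint[OF s1 s2])
    have "x \<notin> range \<psi>" if x: "x \<in> \<phi> ` (-{0})" for x
    proof
      assume "x \<in> range \<psi>"
      then obtain q where "x = \<psi> q" by blast
      moreover obtain p where "x = \<phi> p" using x by blast
      ultimately show False using disj[of p q] by simp
    qed
    then show "\<phi> ` (-{0}) \<inter> range \<psi> = {}" by blast
  qed
  also have "infsum f (\<phi> ` (-{0})) = c ^ k * eisenstein_G k \<tau>"
    unfolding infsum_reindex[OF inj(1)] o_def f\<phi> infsum_cmult_right' eisenstein_G_eq E_def ..
  also have "infsum f (range \<psi>) = c ^ k * E UNIV k h"
    unfolding infsum_reindex[OF inj(2)] o_def f\<psi> infsum_cmult_right' E_def ..
  finally show ?thesis by (simp add: distrib_left)
qed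

lemma half_not_in_lattice:
  assumes "2 * h = pt q" "\<And>p. q \<noteq> p + p"
  shows "h \<notin> range pt"
proof
  assume "h \<in> range pt"
  then obtain p where "h = pt p" by auto
  then have "pt q = pt (p + p)" using assms(1) by (simp add: pt_add)
  then show False using assms(2) pt_inj by blast
qed

text \<open>For \<open>k\<close> equal to 4 and 6, the added term \<open>E UNIV k h\<close> is a
  polynomial in \<open>e1\<close> and \<open>G4\<close> by the half period formulas.\<close>

lemma modular_j_index_two:
  assumes h: "h \<notin> range pt" "2 * h = pt q" and e1: "wp h = e1"
    and e: "e1 + e2 + e3 = 0" "e1 \<noteq> e2" "e1 \<noteq> e3" "e2 \<noteq> e3"
    and g4: "15 * G4 = e1 ^ 2 + e1 * e2 + e2 ^ 2" and g6: "35 * G6 = e1 * e2 * e3"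
    and c: "c \<noteq> 0"
    and G: "\<And>k. k \<ge> 3 \<Longrightarrow> eisenstein_G k \<sigma> = c ^ k * (eisenstein_G k \<tau> + E UNIV k h)"
  shows "modular_j \<sigma> = isogenous_j ((e1 - e2) / (e1 - e3))"
proof (rule modular_j_eq_isogenous_j[OF e c g4 g6])
  note v = half_period_values[OF h, unfolded e1]
  show "eisenstein_G 4 \<sigma> = c ^ 4 * (e1 ^ 2 - 4 * G4)"
    using G[of 4] by (simp add: v(1))
  show "5 * eisenstein_G 6 \<sigma> = c ^ 6 * (5 * G6 + 3 * e1 * (e1 ^ 2 - 5 * G4))"
  proof -
    have "5 * eisenstein_G 6 \<sigma> = c ^ 6 * (5 * G6 + 5 * E UNIV 6 h)"
      using G[of 6] by (simp add: distrib_left)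
    then show ?thesis by (simp only: v(2))
  qed
qed

text \<open>After scaling by 1/2, the parity of the second coordinate decides between the lattice
  and its translate.\<close>

lemma eisenstein_G_double:
  assumes h: "1 / 2 \<notin> range pt" and k: "k \<ge> 3"
  shows "eisenstein_G k (2 * \<tau>) = (1 / 2) ^ k * (eisenstein_G k \<tau> + E UNIV k (1 / 2))"
proof (rule eisenstein_G_index_two[where \<phi> = "\<lambda>(m, n). (m, 2 * n)"
      and \<psi> = "\<lambda>(m, n). (m, 2 * n + 1)", OF _ _ _ _ _ _ _ _ h k])
  fix x :: "int \<times> int"
  obtain m n where x: "x = (m, n)" by force
  show "x \<in> range (\<lambda>(m, n). (m, 2 * n)) \<or> x \<in> range (\<lambda>(m, n). (m, 2 * n + 1))"
    unfolding x by (cases "even n") (auto simp: image_iff elim!: evenE oddE)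
qed (auto simp: inj_on_def zero_prod_def pt_def algebra_simps, presburger)

lemma eisenstein_G_half:
  assumes h: "\<tau> / 2 \<notin> range pt" and k: "k \<ge> 3"
  shows "eisenstein_G k (\<tau> / 2) = 1 ^ k * (eisenstein_G k \<tau> + E UNIV k (\<tau> / 2))"
proof (rule eisenstein_G_index_two[where \<phi> = "\<lambda>(m, n). (2 * m, n)"
      and \<psi> = "\<lambda>(m, n). (2 * m + 1, n)", OF _ _ _ _ _ _ _ _ h k])
  fix x :: "int \<times> int"
  obtain m n where x: "x = (m, n)" by force
  show "x \<in> range (\<lambda>(m, n). (2 * m, n)) \<or> x \<in> range (\<lambda>(m, n). (2 * m + 1, n))"
    unfolding x by (cases "even m") (auto simp: image_iff elim!: evenE oddE)
qed (auto simp: inj_on_def zero_prod_def pt_def field_simps, presburger)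

text \<open>Scaling by \<open>(1 - \<tau>) / 2\<close> turns the generators into
  \<open>(1 + \<tau>) / 2\<close> and \<open>(1 - \<tau>) / 2\<close>, which are congruent modulo
  the lattice of \<open>\<tau>\<close>. Hence the parity of the difference of the coordinates
  decides.\<close>

lemma eisenstein_G_diagonal:
  assumes h: "(1 + \<tau>) / 2 \<notin> range pt" and k: "k \<ge> 3"
  shows "eisenstein_G k ((\<tau> + 1) / (- \<tau> + 1)) =
    ((1 - \<tau>) / 2) ^ k * (eisenstein_G k \<tau> + E UNIV k ((1 + \<tau>) / 2))"
proof (rule eisenstein_G_index_two[where \<phi> = "\<lambda>(m, n). (m + n, n - m)"
      and \<psi> = "\<lambda>(m, n). (m + n + 1, n - m)", OF _ _ _ _ _ _ _ _ h k])
  have nz: "1 - \<tau> \<noteq> 0" using Im_pos by auto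
  then show "(1 - \<tau>) / 2 \<noteq> 0" by simp
  show "(case case p of (m, n) \<Rightarrow> (m + n, n - m) of
      (m, n) \<Rightarrow> of_int m * ((\<tau> + 1) / (- \<tau> + 1)) + of_int n) = pt p / ((1 - \<tau>) / 2)" for p
    using nz by (cases p) (simp add: pt_def field_simps)
  show "(case case p of (m, n) \<Rightarrow> (m + n + 1, n - m) of
      (m, n) \<Rightarrow> of_int m * ((\<tau> + 1) / (- \<tau> + 1)) + of_int n) =
      ((1 + \<tau>) / 2 + pt p) / ((1 - \<tau>) / 2)" for p
    using nz by (cases p) (simp add: pt_def field_simps)
  show "(case p of (m, n) \<Rightarrow> (m + n, n - m)) \<noteq> (case q of (m, n) \<Rightarrow> (m + n + 1, n - m))"
    for p q :: "int \<times> int"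
    by (cases p; cases q; simp; presburger)
  show "inj (\<lambda>(m::int, n::int). (m + n, n - m))" "inj (\<lambda>(m::int, n::int). (m + n + 1, n - m))"
    by (auto simp: inj_on_def)
  show "(case 0 of (m::int, n::int) \<Rightarrow> (m + n, n - m)) = 0"
    by (simp add: zero_prod_def)
next
  fix x :: "int \<times> int"
  obtain m n where x: "x = (m, n)" by force
  show "x \<in> range (\<lambda>(m, n). (m + n, n - m)) \<or> x \<in> range (\<lambda>(m, n). (m + n + 1, n - m))"
  proof (cases "even (m - n)")
    case True
    then obtain k where "m - n = 2 * k" by (elim evenE)
    then have "x = (\<lambda>(m, n). (m + n, n - m)) (k, n + k)" by (simp add: x)
    then show ?thesis by blast
  next
    case False
    then obtain k where "m - n = 2 * k + 1" by (elim oddE)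
    then have "x = (\<lambda>(m, n). (m + n + 1, n - m)) (k, n + k)" by (simp add: x)
    then show ?thesis by blast
  qed
qed

end

section \<open>Relations between the roots and comparison of the two sets\<close>

text \<open>Vieta's formulas for \<open>x ^ 3 - p * x - q\<close>, obtained by subtracting root
  equations and dividing by the difference of the roots.\<close>

lemma cubic_root_relations:
  fixes e1 e2 e3 p q :: complex
  assumes e: "e1 ^ 3 = p * e1 + q" "e2 ^ 3 = p * e2 + q" "e3 ^ 3 = p * e3 + q"
    and ne: "e1 \<noteq> e2" "e1 \<noteq> e3" "e2 \<noteq> e3"
  shows "e1 + e2 + e3 = 0" "p = e1 ^ 2 + e1 * e2 + e2 ^ 2" "q = e1 * e2 * e3"
proof -
  have *: "p = x ^ 2 + x * y + y ^ 2" if "x ^ 3 = p * x + q" "y ^ 3 = p * y + q" "x \<noteq> y" for x y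
  proof -
    have "(x - y) * (x ^ 2 + x * y + y ^ 2 - p) = (x ^ 3 - p * x) - (y ^ 3 - p * y)"
      by (simp add: algebra_simps power2_eq_square power3_eq_cube)
    then have "(x - y) * (x ^ 2 + x * y + y ^ 2 - p) = 0" using that by simp
    then show ?thesis using \<open>x \<noteq> y\<close> by simp
  qed
  show p: "p = e1 ^ 2 + e1 * e2 + e2 ^ 2" using * e ne by blast
  have "p = e1 ^ 2 + e1 * e3 + e3 ^ 2" using * e ne by blast
  then have "(e2 - e3) * (e1 + e2 + e3) = 0"
    using p by (simp add: algebra_simps power2_eq_square)
  then show s: "e1 + e2 + e3 = 0" using ne by simp
  have "q = e1 ^ 3 - p * e1"
    using e(1) by simp
  also have "\<dots> = - e1 * e2 * (e1 + e2)"
    unfolding p by (simp add: algebra_simps power2_eq_square power3_eq_cube)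
  also have "\<dots> = e1 * e2 * e3"
    using s by (simp add: add_eq_0_iff2 minus_equation_iff)
  finally show "q = e1 * e2 * e3" .
qed

theorem theorem3:
  fixes \<tau> lam :: complex
  assumes "Im \<tau> > 0"
    and "lam \<noteq> 0" and "lam \<noteq> 1"
    and "modular_j \<tau> = 256 * ((lam^2 - lam + 1)^3 / (lam^2 - lam)^2)"
  shows "{modular_j (2 * \<tau>), modular_j (\<tau> / 2), modular_j ((\<tau> + 1) / (- \<tau> + 1))} =
         {16 * ((u + 1 / u + 14)^3 / (u + 1 / u - 2)^2) |u. u \<in> {lam, 1 - lam, (lam - 1) / lam}}"
proof -
  interpret half_plane_point \<tau> by standard fact
  define h1 h2 h3 where "h1 = (1/2 :: complex)" and "h2 = \<tau> / 2" and "h3 = (1 + \<tau>) / 2"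
  \<comment> \<open>Each doubled point has an odd coordinate, which keeps the half periods and their
    differences off the lattice.\<close>
  have double: "2 * h1 = pt (0, 1)" "2 * h2 = pt (1, 0)" "2 * h3 = pt (1, 1)"
    "2 * (h2 - h1) = pt (1, -1)" "2 * (h3 - h1) = pt (1, 0)" "2 * (h3 - h2) = pt (0, 1)"
    by (simp_all add: h1_def h2_def h3_def pt_def algebra_simps add_divide_distrib)
  have odd: "(a, b) \<noteq> p + p" if "odd a \<or> odd b" for a b :: int and p
    using that by (cases p) auto
  have h: "h1 \<notin> range pt" "h2 \<notin> range pt" "h3 \<notin> range pt"
    "h2 - h1 \<notin> range pt" "h3 - h1 \<notin> range pt" "h3 - h2 \<notin> range pt"
    by (rule half_not_in_lattice[OF double(1)] half_not_in_lattice[OF double(2)]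
        half_not_in_lattice[OF double(3)] half_not_in_lattice[OF double(4)]
        half_not_in_lattice[OF double(5)] half_not_in_lattice[OF double(6)], rule odd, simp)+
  define e1 e2 e3 where "e1 = wp h1" and "e2 = wp h2" and "e3 = wp h3"
  have ne: "e1 \<noteq> e2" "e1 \<noteq> e3" "e2 \<noteq> e3"
    unfolding e1_def e2_def e3_def
    using wp_half_period_neq[OF h(1,2,4) double(1,2)] wp_half_period_neq[OF h(1,3,5) double(1,3)]
      wp_half_period_neq[OF h(2,3,6) double(2,3)] by auto
  have root: "e1 ^ 3 = 15 * G4 * e1 + 35 * G6" "e2 ^ 3 = 15 * G4 * e2 + 35 * G6"
    "e3 ^ 3 = 15 * G4 * e3 + 35 * G6"
    unfolding e1_def e2_def e3_def
    by (rule half_period_values(3)[OF h(1) double(1)] half_period_values(3)[OF h(2) double(2)]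
        half_period_values(3)[OF h(3) double(3)])+
  note rel1 = cubic_root_relations[OF root ne]
  \<comment> \<open>Permuted roots, so that each half period in turn supplies the first
    root.\<close>
  note rel2 = cubic_root_relations[OF root(2,1,3) ne(1)[symmetric] ne(3,2)]
  note rel3 = cubic_root_relations[OF root(3,1,2) ne(2)[symmetric] ne(3)[symmetric] ne(1)]
  define \<mu> where "\<mu> = (e1 - e2) / (e1 - e3)"
  have \<mu>: "\<mu> \<noteq> 0" "\<mu> \<noteq> 1" using ne by (simp_all add: \<mu>_def)

  have "modular_j (2 * \<tau>) = isogenous_j ((e1 - e2) / (e1 - e3))"
    by (rule modular_j_index_two[where c = "1 / 2",
          OF h(1) double(1) e1_def[symmetric] rel1(1) ne rel1(2,3)])
       (use eisenstein_G_double h(1) in \<open>auto simp: h1_def\<close>)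
  moreover have "modular_j (\<tau> / 2) = isogenous_j ((e2 - e1) / (e2 - e3))"
    by (rule modular_j_index_two[where c = 1, OF h(2) double(2) e2_def[symmetric]
          rel2(1) ne(1)[symmetric] ne(3,2) rel2(2,3)])
       (use eisenstein_G_half h(2) in \<open>auto simp: h2_def\<close>)
  moreover have "modular_j ((\<tau> + 1) / (- \<tau> + 1)) = isogenous_j ((e3 - e1) / (e3 - e2))"
    by (rule modular_j_index_two[where c = "(1 - \<tau>) / 2", OF h(3) double(3) e3_def[symmetric]
          rel3(1) ne(2)[symmetric] ne(3)[symmetric] ne(1) rel3(2,3)])
       (use eisenstein_G_diagonal h(3) assms(1) in \<open>auto simp: h3_def\<close>)
  \<comment> \<open>Permuting the roots acts on \<open>\<mu>\<close> through the anharmonic group;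
    the remaining inversion is harmless.\<close>
  moreover have "isogenous_j ((e2 - e1) / (e2 - e3)) = isogenous_j ((\<mu> - 1) / \<mu>)"
  proof -
    have "(\<mu> - 1) / \<mu> = 1 / ((e2 - e1) / (e2 - e3))"
      using ne by (simp add: \<mu>_def divide_simps) (simp add: algebra_simps)
    then show ?thesis by (simp only: isogenous_j_inverse)
  qed
  moreover have "isogenous_j ((e3 - e1) / (e3 - e2)) = isogenous_j (1 - \<mu>)"
  proof -
    have "1 - \<mu> = 1 / ((e3 - e1) / (e3 - e2))"
      using ne by (simp add: \<mu>_def divide_simps) (simp add: algebra_simps)
    then show ?thesis by (simp only: isogenous_j_inverse)
  qed
  ultimately have "{modular_j (2 * \<tau>), modular_j (\<tau> / 2), modular_j ((\<tau> + 1) / (- \<tau> + 1))} =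
      {isogenous_j \<mu>, isogenous_j (1 - \<mu>), isogenous_j ((\<mu> - 1) / \<mu>)}"
    by (auto simp: \<mu>_def)
  \<comment> \<open>\<open>\<mu>\<close> and \<open>lam\<close> have the same image
    \<open>modular_j \<tau>\<close> under \<open>legendre_j\<close>.\<close>
  also have "\<dots> = {isogenous_j lam, isogenous_j (1 - lam), isogenous_j ((lam - 1) / lam)}"
  proof (rule isogenous_j_orbit)
    have "modular_j \<tau> = legendre_j \<mu>"
      unfolding \<mu>_def using modular_j_eq_legendre_j[OF rel1(1) ne rel1(2,3)] .
    then show "legendre_j \<mu> = legendre_j lam" using assms(4) by (simp add: legendre_j_def)
  qed (use \<mu> assms in auto)
  also have "\<dots> = {isogenous_j u |u. u \<in> {lam, 1 - lam, (lam - 1) / lam}}"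
    by blast
  finally show ?thesis by (simp only: isogenous_j_def)
qed

end
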